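(* Let $\lambda\in(0,\tfrac12)$, $\epsilon>0$, $\rho>0$, and let $m,n$ be positive integers with $N=mn$. Let $\hat X_{N,\rho,\epsilon}(\xi^N)$ be the $\epsilon$-optimal solution set of the inexact compromise decision problem and $X^*_\epsilon$ the $\epsilon$-optimal solution set of the true problem (both defined in the context). Then: 1. For every realization $\xi^N$, $$\Delta(\hat X_{N,\rho,\epsilon}(\xi^N),X^*_\epsilon)\le\frac{\frac2m\sum_{j=1}^m\delta^f_n(\xi^n_j)+\frac1{m^2}\sum_{i,j=1,\,i\ne j}^m\big[\delta^f_n(\xi^n_i)+\delta^f_n(\xi^n_j)\big]}{\epsilon}D_X+2\sqrt{\epsilon/\rho}.$$ 2. $$\mathbb E\big[\Delta(\hat X_{N,\rho,\epsilon}(\tilde\xi^N),X^*_\epsilon)\big]\le\frac{D_XN_F}{\epsilon}\,\frac{8m-4}{m\,n^\lambda}+2\sqrt{\epsilon/\rho}.$$ 3. If in addition $\rho=n$, $D_X>0$, and $C=\frac{\epsilon^{3/2}}{D_X}+\frac{(4m-2)N_F}{m}$, then for every $t\ge0$ $$\Pr\Big\{\frac{\epsilon n^\lambda}{2D_X}\Delta(\hat X_{N,\rho,\epsilon}(\tilde\xi^N),X^*_\epsilon)\ge C+t\Big\}\le m\exp\Big\{-\frac{m^2t^2}{2M_F^2(2m-1)^2}\Big\}.$$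
   Context: $\tilde\xi$ is a random vector on a probability space with values in $\Xi\subset\mathbb R^d$. $X\subset\mathbb R^p$ is a nonempty compact convex set contained in a cube of edge length $D$; $D_X=\max_{x,x'\in X}\|x-x'\|$, with $\|\cdot\|$ the Euclidean norm. $F:X\times\Xi\to\mathbb R$ is a Carathéodory function (continuous in $x$, measurable in $\xi$) such that: (i) for some $L_F$ and $\gamma\in(0,1]$, $|F(x,\xi)-F(y,\xi)|\le L_F\|x-y\|^\gamma$ for all $x,y\in X$, $\xi\in\Xi$; (ii) for some $M_F\in(0,\infty)$, $\sup_{x\in X,\xi\in\Xi}|F(x,\xi)|<M_F$; (iii) $F(\cdot,\xi)$ is convex on $X$ for every $\xi\in\Xi$. True problem: $f(x)=\mathbb E[F(x,\tilde\xi)]$, $\theta^*=\min_{x\in X}f(x)$, $X^*_\epsilon=\{x\in X:f(x)\le\theta^*+\epsilon\}$. Sampling: $\tilde\xi_1,\dots,\tilde\xi_N$ ($N=mn$) are i.i.d. copies of $\tilde\xi$; $\tilde\xi^N$ is the whole sample and $\tilde\xi^n_i=\{\tilde\xi_{(i-1)n+1},\dots,\tilde\xi_{in}\}$ the sample of replication $i$; untilded symbols are realizations. $f_n(x;\xi^n_i)=\frac1n\sum_{j=1}^nF(x,\xi_{(i-1)n+j})$ and $\delta^f_n(\xi^n_i)=\sup_{x\in X}|f_n(x;\xi^n_i)-f(x)|$. Inexact compromise decision problem: for each $i$, $x_{n,\epsilon}(\xi^n_i)$ is a chosen element of $X_{n,\epsilon}(\xi^n_i)=\{x\in X:f_n(x;\xi^n_i)\le\min_{x'\in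 X}f_n(x';\xi^n_i)+\epsilon\}$. With $\bar f_N(x;\xi^N)=\frac1m\sum_{i=1}^mf_n(x;\xi^n_i)$ and $$\theta_{N,\rho,\epsilon}(\xi^N)=\min_{x\in X}\bar f_N(x;\xi^N)+\frac\rho2\Big\|x-\frac1m\sum_{i=1}^mx_{n,\epsilon}(\xi^n_i)\Big\|^2,$$ $$\hat X_{N,\rho,\epsilon}(\xi^N)=\Big\{x\in X:\bar f_N(x;\xi^N)+\frac\rho2\Big\|x-\frac1m\sum_{i=1}^mx_{n,\epsilon}(\xi^n_i)\Big\|^2\le\theta_{N,\rho,\epsilon}(\xi^N)+\epsilon\Big\}.$$ Pessimistic distance: $\Delta(A,B)=\sup_{a\in A}\inf_{b\in B}\|a-b\|$. Constant: $N_F=L_FD^\gamma p^{\gamma/2}+M_F\sqrt{2\log2}+\dfrac{M_Fp^{1/2}}{\sqrt{\gamma(1-2\lambda)e}}$. All selections and random quantities whose expectation or probability is taken are assumed measurable. *)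

theory Defs
  imports "HOL-Probability.Probability"
begin

text \<open>Cubes are not required to be parallel to the coordinate axes.\<close>

definition is_cube :: "(real ^ 'p) set \<Rightarrow> real \<Rightarrow> bool" where
  "is_cube K D \<longleftrightarrow>
     (\<exists>c (Q :: real ^ 'p \<Rightarrow> real ^ 'p). orthogonal_transformation Q \<and>
        K = (\<lambda>y. c + Q y) ` cbox 0 (\<chi> i. D))"

text \<open>Every infimum and supremum below is used for a bounded function on a nonempty set.
  The minima of the mathematical text range over a nonempty compact set and a continuous
  objective, so they agree with the infima used here.\<close>

definition pess_dist :: "'a::real_normed_vector set \<Rightarrow> 'a set \<Rightarrow> real" where
  "pess_dist A B = (SUP a\<in>A. INF b\<in>B. norm (a - b))"

definition eps_argmin :: "'a set \<Rightarrow> ('a \<Rightarrow> real) \<Rightarrow> real \<Rightarrow> 'a set" where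
  "eps_argmin X g \<epsilon> = {x \<in> X. g x \<le> (INF x'\<in>X. g x') + \<epsilon>}"

definition true_obj ::
  "'v measure \<Rightarrow> ('v \<Rightarrow> 'b) \<Rightarrow> ('a \<Rightarrow> 'b \<Rightarrow> real) \<Rightarrow> 'a \<Rightarrow> real" where
  "true_obj P \<xi> F x = (\<integral>v. F x (\<xi> v) \<partial>P)"

text \<open>A sample of size \<open>n\<close> is a function on the indices \<open>1, \<dots>, n\<close>.\<close>

definition saa_obj :: "('a \<Rightarrow> 'b \<Rightarrow> real) \<Rightarrow> nat \<Rightarrow> (nat \<Rightarrow> 'b) \<Rightarrow> 'a \<Rightarrow> real" where
  "saa_obj F n \<zeta> x = (1 / real n) * (\<Sum>j=1..n. F x (\<zeta> j))"

text \<open>The sample of replication \<open>i \<in> {1..m}\<close>, re-indexed by \<open>1, \<dots>, n\<close>.  Restricting it to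
  these indices makes a selection that is a function of \<open>replication n z i\<close> depend on
  that part of the whole sample \<open>z\<close> only.\<close>

definition replication :: "nat \<Rightarrow> (nat \<Rightarrow> 'b) \<Rightarrow> nat \<Rightarrow> nat \<Rightarrow> 'b" where
  "replication n z i = (\<lambda>j\<in>{1..n}. z ((i - 1) * n + j))"

definition saa_error ::
  "'a set \<Rightarrow> ('a \<Rightarrow> 'b \<Rightarrow> real) \<Rightarrow> ('a \<Rightarrow> real) \<Rightarrow> nat \<Rightarrow> (nat \<Rightarrow> 'b) \<Rightarrow> real" where
  "saa_error X F f n \<zeta> = (SUP x\<in>X. \<bar>saa_obj F n \<zeta> x - f x\<bar>)"

definition avg_obj ::
  "('a \<Rightarrow> 'b \<Rightarrow> real) \<Rightarrow> nat \<Rightarrow> nat \<Rightarrow> (nat \<Rightarrow> 'b) \<Rightarrow> 'a \<Rightarrow> real" where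
  "avg_obj F m n z x = (1 / real m) * (\<Sum>i=1..m. saa_obj F n (replication n z i) x)"

definition avg_decision ::
  "(nat \<Rightarrow> (nat \<Rightarrow> 'b) \<Rightarrow> 'a::real_normed_vector) \<Rightarrow> nat \<Rightarrow> nat \<Rightarrow> (nat \<Rightarrow> 'b) \<Rightarrow> 'a" where
  "avg_decision sel m n z = (1 / real m) *\<^sub>R (\<Sum>i=1..m. sel i (replication n z i))"

definition compromise_obj ::
  "('a::real_normed_vector \<Rightarrow> 'b \<Rightarrow> real) \<Rightarrow> (nat \<Rightarrow> (nat \<Rightarrow> 'b) \<Rightarrow> 'a) \<Rightarrow> nat \<Rightarrow> nat \<Rightarrow> real \<Rightarrow>
    (nat \<Rightarrow> 'b) \<Rightarrow> 'a \<Rightarrow> real" where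
  "compromise_obj F sel m n \<rho> z x =
     avg_obj F m n z x + \<rho> / 2 * (norm (x - avg_decision sel m n z))\<^sup>2"

definition compromise_set ::
  "'a::real_normed_vector set \<Rightarrow> ('a \<Rightarrow> 'b \<Rightarrow> real) \<Rightarrow> (nat \<Rightarrow> (nat \<Rightarrow> 'b) \<Rightarrow> 'a) \<Rightarrow>
    nat \<Rightarrow> nat \<Rightarrow> real \<Rightarrow> real \<Rightarrow> (nat \<Rightarrow> 'b) \<Rightarrow> 'a set" where
  "compromise_set X F sel m n \<rho> \<epsilon> z = eps_argmin X (compromise_obj F sel m n \<rho> z) \<epsilon>"

definition rate_const :: "nat \<Rightarrow> real \<Rightarrow> real \<Rightarrow> real \<Rightarrow> real \<Rightarrow> real \<Rightarrow> real" where
  "rate_const p L D M \<gamma> lam =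
     L * D powr \<gamma> * real p powr (\<gamma> / 2) + M * sqrt (2 * ln 2)
     + M * real p powr (1 / 2) / sqrt (\<gamma> * (1 - 2 * lam) * exp 1)"

end

theory Submission
  imports Defs
begin

text \<open>By convexity, a point of \<open>X\<close> whose true objective exceeds \<open>\<theta>\<^sup>* + \<epsilon>\<close> by at most \<open>\<eta>\<close> lies
  within \<open>(\<eta> / \<epsilon>) D\<^sub>X\<close> of the \<open>\<epsilon>\<close>-optimal set: move it towards a nearly optimal point.  If the proximal
  term of an \<open>\<epsilon>\<close>-optimal compromise decision is at least \<open>\<epsilon>\<close>, this is applied to the
  decision itself; otherwise the decision is within \<open>2 \<surd>(\<epsilon> / \<rho>)\<close> of the averaged decision, to which
  it is applied instead.

  For the probabilistic bounds, cut the cube into \<open>\<nu>\<^sup>p\<close> cells with \<open>\<nu> = \<lceil>n powr (1 / (2 \<gamma>))\<rceil>\<close>.  By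
  Hoelder continuity the uniform error is at most a deterministic mesh term plus the
  maximal deviation over one point per cell.  Hoeffding's lemma bounds the mean of that maximum by
  \<open>M\<^sub>F \<surd>(2 ln (2 \<nu>\<^sup>p) / n)\<close>.  The tail needs no bounded-difference inequality: in
  Hoeffding's inequality at level \<open>a + u\<close>, where \<open>a\<close> is this mean bound, the factor
  \<open>exp (- n a\<^sup>2 / (2 M\<^sub>F\<^sup>2))\<close> cancels the cardinality factor of the union bound exactly.\<close>

subsection \<open>Stability of compromise decisions\<close>

text \<open>A fraction \<open>\<eta> / \<epsilon>\<close> of the segment towards a nearly optimal
  point removes the excess \<open>\<eta>\<close>, and the displacement is that fraction of a
  distance within \<open>X\<close>. Once \<open>\<epsilon> < \<eta>\<close>, the bound is at least
  the diameter and any point of the \<open>\<epsilon>\<close>-optimal set serves.\<close>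

lemma near_optimal_dist_eps_argmin:
  fixes X :: "'a::real_normed_vector set"
  assumes f: "convex_on X f" and X: "bounded X" and bdd: "bdd_below (f ` X)"
    and x: "x \<in> X" and fx: "f x \<le> (INF y\<in>X. f y) + \<epsilon> + \<eta>"
    and \<epsilon>: "0 < \<epsilon>" and \<eta>: "0 \<le> \<eta>"
  obtains b where "b \<in> eps_argmin X f \<epsilon>" and "norm (x - b) \<le> \<eta> / \<epsilon> * diameter X"
proof -
  let ?\<theta> = "INF y\<in>X. f y"
  have "X \<noteq> {}" using x by auto
  have approx: "\<exists>y\<in>X. f y < ?\<theta> + \<kappa>" if "0 < \<kappa>" for \<kappa>
    using cINF_less_iff[OF \<open>X \<noteq> {}\<close> bdd, of "?\<theta> + \<kappa>"] that by simp
  have diam: "norm (x - y) \<le> diameter X" if "y \<in> X" for y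
    using diameter_bounded_bound[OF X x that] by (simp add: dist_norm)
  consider "\<eta> = 0" | "0 < \<eta>" "\<eta> \<le> \<epsilon>" | "\<epsilon> < \<eta>" using \<eta> by linarith
  then show thesis
  proof cases
    case 1
    then show thesis using that[of x] x fx by (simp add: eps_argmin_def)
  next
    case 2
    define t where "t = \<eta> / \<epsilon>"
    have t: "0 \<le> t" "t \<le> 1" "\<epsilon> * t = \<eta>" using 2 \<epsilon> by (simp_all add: t_def)
    \<comment> \<open>The infimum need not be attained. A gap of \<open>\<eta>\<close> is
      affordable: combining \<open>?\<theta> + \<epsilon> + \<eta>\<close> and
      \<open>?\<theta> + \<eta>\<close> with weights \<open>1 - t\<close> and \<open>t\<close> gives
      exactly \<open>?\<theta> + \<epsilon>\<close>.\<close>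
    obtain y where y: "y \<in> X" "f y < ?\<theta> + \<eta>" using approx 2 by blast
    let ?b = "(1 - t) *\<^sub>R x + t *\<^sub>R y"
    have bX: "?b \<in> X"
      using f x y t unfolding convex_on_def by (intro convexD) auto
    have "f ?b \<le> (1 - t) * f x + t * f y"
      by (rule convex_onD[OF f]) (use t x y in auto)
    also have "\<dots> \<le> (1 - t) * (?\<theta> + \<epsilon> + \<eta>) + t * (?\<theta> + \<eta>)"
      using t fx y by (intro add_mono mult_left_mono) auto
    also have "\<dots> = ?\<theta> + \<epsilon>" using t by (simp add: algebra_simps)
    finally have "?b \<in> eps_argmin X f \<epsilon>" using bX by (simp add: eps_argmin_def)
    moreover have "norm (x - ?b) = t * norm (x - y)"
    proof -
      have "x - ?b = t *\<^sub>R (x - y)" by (simp add: algebra_simps)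
      then show ?thesis using t by simp
    qed
    ultimately show thesis
      using that[of ?b] diam[OF y(1)] t by (simp add: t_def[symmetric] mult_left_mono)
  next
    case 3
    obtain y where y: "y \<in> X" "f y < ?\<theta> + \<epsilon>" using approx \<epsilon> by blast
    have "norm (x - y) \<le> 1 * diameter X" using diam y by simp
    also have "\<dots> \<le> \<eta> / \<epsilon> * diameter X"
      using 3 \<epsilon> X by (intro mult_right_mono diameter_ge_0) auto
    finally show thesis using that[of y] y by (simp add: eps_argmin_def)
  qed
qed

text \<open>Replications enter only as convex functions \<open>g i\<close> close to
  \<open>f\<close>, so the argument is deterministic. Of the two copies of the mean error, one comes
  from replacing \<open>f\<close> by the average of the \<open>g i\<close>, the other from comparing
  their minimal values with that of \<open>f\<close>. The double sum comes from evaluating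
  \<open>g j\<close> at the decision \<open>y i\<close> of another replication.\<close>

lemma compromise_dist_le:
  fixes X :: "'a::real_normed_vector set" and g :: "nat \<Rightarrow> 'a \<Rightarrow> real" and y :: "nat \<Rightarrow> 'a"
  assumes f: "convex_on X f" and X: "bounded X" and bdd: "bdd_below (f ` X)"
    and g: "\<And>i. i \<in> {1..m} \<Longrightarrow> convex_on X (g i)"
    and err: "\<And>i x. i \<in> {1..m} \<Longrightarrow> x \<in> X \<Longrightarrow> \<bar>g i x - f x\<bar> \<le> \<delta> i"
    and y: "\<And>i. i \<in> {1..m} \<Longrightarrow> y i \<in> eps_argmin X (g i) \<epsilon>"
    and x: "x \<in> eps_argmin X (\<lambda>x. 1 / real m * (\<Sum>i=1..m. g i x)
              + \<rho> / 2 * (norm (x - (1 / real m) *\<^sub>R (\<Sum>i=1..m. y i)))\<^sup>2) \<epsilon>"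
    and \<epsilon>: "0 < \<epsilon>" and \<rho>: "0 < \<rho>" and m: "0 < m"
  obtains b where "b \<in> eps_argmin X f \<epsilon>"
    and "norm (x - b) \<le> (2 / real m * (\<Sum>j=1..m. \<delta> j)
           + 1 / (real m)\<^sup>2 * (\<Sum>i=1..m. \<Sum>j\<in>{1..m} - {i}. \<delta> i + \<delta> j)) / \<epsilon> * diameter X
           + 2 * sqrt (\<epsilon> / \<rho>)"
proof -
  define S where "S = 1 / real m * (\<Sum>j=1..m. \<delta> j)"
  define E where "E = 1 / (real m)\<^sup>2 * (\<Sum>i=1..m. \<Sum>j\<in>{1..m} - {i}. \<delta> i + \<delta> j)"
  define G where "G x = 1 / real m * (\<Sum>i=1..m. g i x)" for x
  define c where "c i = (INF x\<in>X. g i x)" for i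
  define a where "a = (1 / real m) *\<^sub>R (\<Sum>i=1..m. y i)"
  let ?\<theta> = "INF x\<in>X. f x"
  have xX: "x \<in> X" using x by (simp add: eps_argmin_def)
  then have ne: "X \<noteq> {}" by auto
  have yX: "y i \<in> X" and yc: "g i (y i) \<le> c i + \<epsilon>" if "i \<in> {1..m}" for i
    using y[OF that] by (auto simp: eps_argmin_def c_def)
  have \<delta>0: "0 \<le> \<delta> i" if "i \<in> {1..m}" for i using err[OF that xX] by linarith
  have S0: "0 \<le> S" unfolding S_def by (intro mult_nonneg_nonneg sum_nonneg \<delta>0) auto
  have E0: "0 \<le> E" unfolding E_def
    by (intro mult_nonneg_nonneg sum_nonneg add_nonneg_nonneg \<delta>0) auto
  have f_ge: "?\<theta> \<le> f v" if "v \<in> X" for v using cINF_lower[OF bdd that] .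
  have g_bdd: "bdd_below (g i ` X)" if "i \<in> {1..m}" for i
  proof (rule bdd_belowI2)
    fix v assume "v \<in> X" then show "?\<theta> - \<delta> i \<le> g i v" using err[OF that] f_ge by force
  qed
  have c_le: "c i \<le> g i v" if "i \<in> {1..m}" "v \<in> X" for i v
    unfolding c_def using cINF_lower[OF g_bdd] that by blast
  have c_le_\<theta>: "c i \<le> ?\<theta> + \<delta> i" if i: "i \<in> {1..m}" for i
  proof -
    have "c i - \<delta> i \<le> ?\<theta>"
    proof (rule cINF_greatest[OF ne])
      fix v assume "v \<in> X"
      then show "c i - \<delta> i \<le> f v" using c_le[OF i] err[OF i] by force
    qed
    then show ?thesis by simp
  qed
  have avg_const: "1 / real m * (\<Sum>i=1..m. k) = k" for k :: real using m by simp
  have f_le_G: "f v \<le> G v + S" if "v \<in> X" for v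
  proof -
    have "f v = 1 / real m * (\<Sum>i=1..m. f v)" using avg_const by simp
    also have "\<dots> \<le> 1 / real m * (\<Sum>i=1..m. g i v + \<delta> i)"
      using err that by (intro mult_left_mono sum_mono) (auto simp: abs_le_iff, smt (verit) atLeastAtMost_iff)
    also have "\<dots> = G v + S" by (simp add: G_def S_def sum.distrib distrib_left)
    finally show ?thesis .
  qed
  have G_ge: "1 / real m * (\<Sum>i=1..m. c i) \<le> G v" if "v \<in> X" for v
    unfolding G_def using c_le that by (intro mult_left_mono sum_mono) auto
  have avg_c: "1 / real m * (\<Sum>i=1..m. c i) \<le> ?\<theta> + S"
  proof -
    have "1 / real m * (\<Sum>i=1..m. c i) \<le> 1 / real m * (\<Sum>i=1..m. ?\<theta> + \<delta> i)"
      using c_le_\<theta> by (intro mult_left_mono sum_mono) auto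
    also have "\<dots> = ?\<theta> + S"
      using m by (simp add: S_def sum.distrib distrib_left)
    finally show ?thesis .
  qed
  have a_sum: "a = (\<Sum>i=1..m. (1 / real m) *\<^sub>R y i)" by (simp add: a_def scaleR_sum_right)
  have aX: "a \<in> X"
    unfolding a_sum by (rule convex_sum) (use f yX m in \<open>auto simp: convex_on_def\<close>)
  have G_a: "G a \<le> 1 / real m * (\<Sum>i=1..m. c i) + \<epsilon> + E"
  proof -
    \<comment> \<open>Jensen's inequality for each \<open>g j\<close> at the averaged decision; the
      sums are then swapped so that for fixed \<open>i\<close> all \<open>g j\<close> are evaluated
      at the same point \<open>y i\<close>.\<close>
    have "G a \<le> 1 / real m * (\<Sum>j=1..m. \<Sum>i=1..m. (1 / real m) * g j (y i))"
      unfolding G_def a_sum using m g yX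
      by (intro mult_left_mono sum_mono convex_on_sum[where C = X]) auto
    also have "\<dots> = 1 / (real m)\<^sup>2 * (\<Sum>i=1..m. \<Sum>j=1..m. g j (y i))"
      by (subst sum.swap) (simp add: sum_distrib_left power2_eq_square mult.assoc)
    also have "\<dots> \<le> 1 / (real m)\<^sup>2 *
        (\<Sum>i=1..m. real m * (c i + \<epsilon>) + (\<Sum>j\<in>{1..m} - {i}. \<delta> i + \<delta> j))"
    proof (intro mult_left_mono sum_mono)
      fix i assume i: "i \<in> {1..m}"
      have "(\<Sum>j=1..m. g j (y i)) = g i (y i) + (\<Sum>j\<in>{1..m} - {i}. g j (y i))"
        using i by (simp add: sum.remove)
      \<comment> \<open>The diagonal term is within \<open>\<epsilon>\<close> of its own minimal
        value. For \<open>j \<noteq> i\<close>, passing from \<open>g j\<close> to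
        \<open>g i\<close> through \<open>f\<close> at the point \<open>y i\<close> costs
        \<open>\<delta> j + \<delta> i\<close>.\<close>
      also have "\<dots> \<le> (c i + \<epsilon>) + (\<Sum>j\<in>{1..m} - {i}. (c i + \<epsilon>) + (\<delta> i + \<delta> j))"
      proof (intro add_mono sum_mono yc[OF i])
        fix j assume "j \<in> {1..m} - {i}"
        then show "g j (y i) \<le> c i + \<epsilon> + (\<delta> i + \<delta> j)"
          using err[OF i yX[OF i]] err[OF _ yX[OF i], of j] yc[OF i] by force
      qed
      also have "\<dots> = (\<Sum>j=1..m. c i + \<epsilon>) + (\<Sum>j\<in>{1..m} - {i}. \<delta> i + \<delta> j)"
        using i by (subst sum.remove[of "{1..m}" i "\<lambda>_. c i + \<epsilon>"]) (auto simp only: sum.distrib finite_atLeastAtMost add.assoc)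
      finally show "(\<Sum>j=1..m. g j (y i)) \<le> real m * (c i + \<epsilon>) + (\<Sum>j\<in>{1..m} - {i}. \<delta> i + \<delta> j)"
        by simp
    qed simp
    also have "\<dots> = 1 / real m * (\<Sum>i=1..m. c i) + \<epsilon> + E"
      using m by (simp add: E_def sum.distrib sum_distrib_left[symmetric] distrib_left power2_eq_square)
    finally show ?thesis .
  qed
  let ?q = "\<rho> / 2 * (norm (x - a))\<^sup>2"
  \<comment> \<open>The competitor is \<open>a\<close>, which lies in \<open>X\<close> by convexity
    and has vanishing proximal term.\<close>
  have obj: "G x + ?q \<le> G a + \<epsilon>"
  proof -
    let ?h = "\<lambda>x. G x + \<rho> / 2 * (norm (x - a))\<^sup>2"
    have "bdd_below (?h ` X)"
    proof (rule bdd_belowI2)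
      fix v assume "v \<in> X"
      then show "1 / real m * (\<Sum>i=1..m. c i) \<le> ?h v" using G_ge \<rho> by (simp add: add_increasing2)
    qed
    from cINF_lower[OF this aX] have "(INF v\<in>X. ?h v) \<le> G a" by simp
    moreover have "?h x \<le> (INF v\<in>X. ?h v) + \<epsilon>"
      using x by (simp add: eps_argmin_def G_def a_def)
    ultimately show ?thesis by simp
  qed
  have goal: "2 / real m * (\<Sum>j=1..m. \<delta> j)
           + 1 / (real m)\<^sup>2 * (\<Sum>i=1..m. \<Sum>j\<in>{1..m} - {i}. \<delta> i + \<delta> j) = 2 * S + E"
    by (simp add: S_def E_def)
  show thesis
  proof (cases "\<epsilon> \<le> ?q")
    case True
    \<comment> \<open>The tolerance \<open>\<epsilon>\<close> of the compromise problem is cancelled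
      by the proximal term; the \<open>\<epsilon>\<close> that remains is the one of the individual
      decisions, contained in \<open>G_a\<close>.\<close>
    have "f x \<le> ?\<theta> + \<epsilon> + (2 * S + E)"
      using f_le_G[OF xX] obj G_a avg_c True by linarith
    from near_optimal_dist_eps_argmin[OF f X bdd xX this \<epsilon>] S0 E0
    obtain b where b: "b \<in> eps_argmin X f \<epsilon>" "norm (x - b) \<le> (2 * S + E) / \<epsilon> * diameter X"
      by auto
    moreover have "0 \<le> 2 * sqrt (\<epsilon> / \<rho>)" using \<epsilon> \<rho> by simp
    ultimately show thesis by (intro that[unfolded goal, OF b(1)]) linarith
  next
    case False
    have "f a \<le> ?\<theta> + \<epsilon> + (2 * S + E)"
      using f_le_G[OF aX] G_a avg_c by linarith
    from near_optimal_dist_eps_argmin[OF f X bdd aX this \<epsilon>] S0 E0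
    obtain b where b: "b \<in> eps_argmin X f \<epsilon>" "norm (a - b) \<le> (2 * S + E) / \<epsilon> * diameter X"
      by auto
    \<comment> \<open>The proximal term even gives \<open>2 * (\<epsilon> / \<rho>)\<close>; the
      constant 4 is the one that matches the stated bound.\<close>
    have "(norm (x - a))\<^sup>2 \<le> 4 * (\<epsilon> / \<rho>)"
      using False \<epsilon> \<rho> by (simp add: field_simps)
    then have "norm (x - a) \<le> sqrt (4 * (\<epsilon> / \<rho>))" by (rule real_le_rsqrt)
    also have "\<dots> = 2 * sqrt (\<epsilon> / \<rho>)" by (simp only: real_sqrt_mult real_sqrt_four)
    finally have "norm (x - b) \<le> (2 * S + E) / \<epsilon> * diameter X + 2 * sqrt (\<epsilon> / \<rho>)"
      using norm_triangle_ineq[of "x - a" "a - b"] b by simp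
    then show thesis using that[unfolded goal] b by blast
  qed
qed

subsection \<open>Deviations over a finite class\<close>

text \<open>Independence factors the exponential moment, and Hoeffding's lemma bounds each factor.
  Nonnegative integrals keep integrability questions out of the product formula.\<close>

lemma (in Hoeffding_ineq) nn_integral_exp_sum_le:
  assumes l: "0 < l"
  shows "(\<integral>\<^sup>+x. ennreal (exp (l * ((\<Sum>i\<in>I. X i x) - \<mu>))) \<partial>M)
           \<le> ennreal (exp (l\<^sup>2 * (\<Sum>i\<in>I. (b i - a i)\<^sup>2) / 8))"
proof -
  have "(\<integral>\<^sup>+x. ennreal (exp (l * ((\<Sum>i\<in>I. X i x) - \<mu>))) \<partial>M)
      = (\<integral>\<^sup>+x. (\<Prod>i\<in>I. ennreal (exp (l * (X i x - expectation (X i))))) \<partial>M)"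
    by (intro nn_integral_cong)
       (simp add: \<mu>_def sum_subtractf[symmetric] sum_distrib_left exp_sum fin prod_ennreal)
  also have "\<dots> = (\<Prod>i\<in>I. \<integral>\<^sup>+x. ennreal (exp (l * (X i x - expectation (X i)))) \<partial>M)"
    by (intro indep_vars_nn_integral fin indep_vars_compose2[OF indep]) auto
  also have "\<dots> \<le> (\<Prod>i\<in>I. ennreal (exp (l\<^sup>2 * (b i - a i)\<^sup>2 / 8)))"
  proof (intro prod_mono_ennreal)
    fix i assume "i \<in> I"
    then interpret interval_bounded_random_variable M "X i" "a i" "b i" ..
    show "(\<integral>\<^sup>+x. ennreal (exp (l * (X i x - expectation (X i)))) \<partial>M)
            \<le> ennreal (exp (l\<^sup>2 * (b i - a i)\<^sup>2 / 8))"
      using Hoeffdings_lemma_nn_integral[OF l] by simp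
  qed
  also have "\<dots> = ennreal (exp (l\<^sup>2 * (\<Sum>i\<in>I. (b i - a i)\<^sup>2) / 8))"
    by (simp add: prod_ennreal exp_sum[symmetric] fin sum_distrib_left sum_divide_distrib)
  finally show ?thesis .
qed

text \<open>Since \<open>exp (l * \<bar>s\<bar>)\<close> is at most
  \<open>exp (l * s) + exp (- l * s)\<close>, the one-sided bound is applied to the variables and to
  their negatives, whose ranges have the same lengths.\<close>

lemma (in Hoeffding_ineq) nn_integral_exp_abs_sum_le:
  assumes l: "0 < l"
  shows "(\<integral>\<^sup>+x. ennreal (exp (l * \<bar>(\<Sum>i\<in>I. X i x) - \<mu>\<bar>)) \<partial>M)
           \<le> ennreal (2 * exp (l\<^sup>2 * (\<Sum>i\<in>I. (b i - a i)\<^sup>2) / 8))"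
proof -
  interpret flip: Hoeffding_ineq M I "\<lambda>i x. - X i x" "\<lambda>i. - b i" "\<lambda>i. - a i" "- \<mu>"
  proof unfold_locales
    fix i assume "i \<in> I"
    then interpret interval_bounded_random_variable M "X i" "a i" "b i" ..
    show "AE x in M. - X i x \<in> {- b i..- a i}"
      by (intro eventually_mono[OF AE_in_interval]) auto
  qed (auto simp: fin \<mu>_def sum_negf intro: indep_vars_compose2[OF indep])
  let ?A = "exp (l\<^sup>2 * (\<Sum>i\<in>I. (b i - a i)\<^sup>2) / 8)"
  have "(\<integral>\<^sup>+x. ennreal (exp (l * \<bar>(\<Sum>i\<in>I. X i x) - \<mu>\<bar>)) \<partial>M)
      \<le> (\<integral>\<^sup>+x. ennreal (exp (l * ((\<Sum>i\<in>I. X i x) - \<mu>)))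
            + ennreal (exp (l * ((\<Sum>i\<in>I. - X i x) - (- \<mu>)))) \<partial>M)"
    by (intro nn_integral_mono)
       (auto simp: abs_if sum_negf algebra_simps ennreal_plus[symmetric] simp del: ennreal_plus
             intro!: ennreal_leI)
  also have "\<dots> = (\<integral>\<^sup>+x. ennreal (exp (l * ((\<Sum>i\<in>I. X i x) - \<mu>))) \<partial>M)
                 + (\<integral>\<^sup>+x. ennreal (exp (l * ((\<Sum>i\<in>I. - X i x) - (- \<mu>)))) \<partial>M)"
    by (intro nn_integral_add) auto
  also have "\<dots> \<le> ennreal ?A + ennreal ?A"
    using nn_integral_exp_sum_le[OF l] flip.nn_integral_exp_sum_le[OF l]
    by (intro add_mono) auto
  also have "\<dots> = ennreal (2 * ?A)"
    by (simp add: ennreal_plus[symmetric] del: ennreal_plus)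
  finally show ?thesis .
qed

text \<open>A maximum over \<open>2 * card C\<close> signed deviations, each controlled by
  Hoeffding's lemma with ranges of length \<open>2 * B\<close>. The level \<open>\<alpha>\<close> is
  the solution of \<open>card J * \<alpha>\<^sup>2 = 2 * B\<^sup>2 * ln (2 * card C)\<close>; this
  identity drives both the mean bound and the tail.\<close>

lemma (in prob_space) finite_class_deviation:
  fixes Y :: "'k \<Rightarrow> 'a \<Rightarrow> 'b" and g :: "'c \<Rightarrow> 'b \<Rightarrow> real" and B :: real
  assumes C: "finite C" "C \<noteq> {}" and J: "finite J" "J \<noteq> {}" and B: "0 < B"
    and indep: "indep_vars (\<lambda>_. N) Y J"
    and distr: "\<And>k. k \<in> J \<Longrightarrow> distr M N (Y k) = Q"
    and g: "\<And>c. c \<in> C \<Longrightarrow> g c \<in> borel_measurable N"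
    and gB: "\<And>c z. c \<in> C \<Longrightarrow> z \<in> space N \<Longrightarrow> \<bar>g c z\<bar> \<le> B"
  defines "W \<equiv> \<lambda>\<omega>. MAX c\<in>C. \<bar>(\<Sum>k\<in>J. g c (Y k \<omega>)) / real (card J) - (\<integral>z. g c z \<partial>Q)\<bar>"
    and "\<alpha> \<equiv> B * sqrt (2 * ln (2 * real (card C)) / real (card J))"
  shows "integrable M W"
    and "expectation W \<le> \<alpha>"
    and "\<And>u. 0 \<le> u \<Longrightarrow> prob {\<omega> \<in> space M. \<alpha> + u \<le> W \<omega>} \<le> exp (- (real (card J) * u\<^sup>2 / (2 * B\<^sup>2)))"
proof -
  define n where "n = real (card J)"
  define K where "K = real (card C)"
  define \<mu> where "\<mu> c = (\<integral>z. g c z \<partial>Q)" for c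
  define S where "S c \<omega> = (\<Sum>k\<in>J. g c (Y k \<omega>)) - n * \<mu> c" for c \<omega>
  have n: "0 < n" using J by (simp add: n_def card_gt_0_iff)
  have K: "1 \<le> K" using C by (simp add: K_def Suc_le_eq card_gt_0_iff)
  have Y [measurable]: "Y k \<in> measurable M N" if "k \<in> J" for k
    using indep that unfolding indep_vars_def by blast
  note Y_space = measurable_space[OF Y]
  note [measurable] = g
  have [measurable]: "S c \<in> borel_measurable M" if "c \<in> C" for c
    unfolding S_def using that by measurable
  have Hoeff: "Hoeffding_ineq M J (\<lambda>k \<omega>. g c (Y k \<omega>)) (\<lambda>_. - B) (\<lambda>_. B)"
    if c: "c \<in> C" for c
  proof unfold_locales
    show "indep_vars (\<lambda>_. borel) (\<lambda>k \<omega>. g c (Y k \<omega>)) J"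
      by (rule indep_vars_compose2[OF indep]) (use c g in auto)
    show "AE \<omega> in M. g c (Y k \<omega>) \<in> {- B..B}" if "k \<in> J" for k
    proof (rule AE_I2)
      fix \<omega> assume "\<omega> \<in> space M"
      then have "Y k \<omega> \<in> space N" using Y_space \<open>k \<in> J\<close> by blast
      then show "g c (Y k \<omega>) \<in> {- B..B}" using gB[OF c] by (simp add: abs_le_iff) (smt (verit))
    qed
  qed (use J in auto)
  have mean: "(\<Sum>k\<in>J. expectation (\<lambda>\<omega>. g c (Y k \<omega>))) = n * \<mu> c" if c: "c \<in> C" for c
  proof -
    have "expectation (\<lambda>\<omega>. g c (Y k \<omega>)) = \<mu> c" if "k \<in> J" for k
      using that c unfolding \<mu>_def distr[OF that, symmetric] by (subst integral_distr) auto
    then show ?thesis by (simp add: n_def)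
  qed
  have W_S: "W \<omega> = (MAX c\<in>C. \<bar>S c \<omega>\<bar> / n)" for \<omega>
  proof -
    have "\<bar>(\<Sum>k\<in>J. g c (Y k \<omega>)) / real (card J) - (\<integral>z. g c z \<partial>Q)\<bar> = \<bar>S c \<omega>\<bar> / n" for c
      using n by (simp add: S_def \<mu>_def n_def[symmetric] field_simps abs_divide[symmetric] del: abs_divide)
        (simp add: abs_divide)
    then show ?thesis by (simp add: W_def)
  qed
  have S_le: "\<bar>S c \<omega>\<bar> / n \<le> W \<omega>" if "c \<in> C" for c \<omega>
    unfolding W_S using C that by (intro Max_ge) auto
  have W_attained: "\<exists>c\<in>C. W \<omega> = \<bar>S c \<omega>\<bar> / n" for \<omega>
  proof -
    have "W \<omega> \<in> (\<lambda>c. \<bar>S c \<omega>\<bar> / n) ` C" unfolding W_S using C by (intro Max_in) auto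
    then show ?thesis by auto
  qed
  have [measurable]: "W \<in> borel_measurable M"
    unfolding W_S[abs_def] using C by (intro borel_measurable_Max) auto
  \<comment> \<open>A crude bound that serves integrability only; the rates come from the
    exponential estimates below.\<close>
  have W_bound: "\<bar>W \<omega>\<bar> \<le> B + (MAX c\<in>C. \<bar>\<mu> c\<bar>)" if \<omega>: "\<omega> \<in> space M" for \<omega>
  proof -
    obtain c where c: "c \<in> C" "W \<omega> = \<bar>S c \<omega>\<bar> / n" using W_attained by blast
    have "\<bar>\<Sum>k\<in>J. g c (Y k \<omega>)\<bar> \<le> (\<Sum>k\<in>J. B)"
    proof (rule sum_norm_le[where 'a = real, simplified])
      fix k assume "k \<in> J"
      then show "\<bar>g c (Y k \<omega>)\<bar> \<le> B" using \<omega> by (intro gB c Y_space)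
    qed
    then have "\<bar>S c \<omega>\<bar> \<le> n * B + n * \<bar>\<mu> c\<bar>"
      using n abs_triangle_ineq4[of "\<Sum>k\<in>J. g c (Y k \<omega>)" "n * \<mu> c"]
      by (simp add: S_def n_def abs_mult)
    also have "\<dots> \<le> n * B + n * (MAX c\<in>C. \<bar>\<mu> c\<bar>)"
      using n c C by (intro add_mono mult_left_mono Max_ge) auto
    finally have "\<bar>S c \<omega>\<bar> / n \<le> (n * B + n * (MAX c\<in>C. \<bar>\<mu> c\<bar>)) / n"
      using n by (intro divide_right_mono) auto
    then show ?thesis using n c by (simp add: add_divide_distrib)
  qed
  show "integrable M W"
    using W_bound by (intro integrable_const_bound[where B = "B + (MAX c\<in>C. \<bar>\<mu> c\<bar>)"] AE_I2) auto
  have var: "(\<Sum>k\<in>J. (B - - B)\<^sup>2) = 4 * n * B\<^sup>2"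
    by (simp add: n_def power2_eq_square)
  have ln2K: "0 < ln (2 * K)" using K by simp
  have \<alpha>_eq: "\<alpha> = B * sqrt (2 * ln (2 * K) / n)" by (simp add: \<alpha>_def K_def n_def)
  have \<alpha>0: "0 < \<alpha>" using B ln2K n by (simp add: \<alpha>_eq)
  have \<alpha>2: "n * \<alpha>\<^sup>2 = 2 * B\<^sup>2 * ln (2 * K)"
    using n ln2K by (simp add: \<alpha>_eq power_mult_distrib)

  show "expectation W \<le> \<alpha>"
  proof -
    \<comment> \<open>This \<open>l\<close> minimises
      \<open>(ln (2 * K) + l\<^sup>2 * n * B\<^sup>2 / 2) / (l * n)\<close>, the bound on the mean
      that the exponential moment yields; the minimum is \<open>\<alpha>\<close>.\<close>
    define l where "l = \<alpha> / B\<^sup>2"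
    define A where "A = 2 * K * exp (l\<^sup>2 * (4 * n * B\<^sup>2) / 8)"
    have l: "0 < l" using \<alpha>0 B by (simp add: l_def)
    have A: "0 < A" using K by (simp add: A_def)
    have exp_W: "exp (l * n * W \<omega>) \<le> (\<Sum>c\<in>C. exp (l * \<bar>S c \<omega>\<bar>))" for \<omega>
    proof -
      obtain c where c: "c \<in> C" "W \<omega> = \<bar>S c \<omega>\<bar> / n" using W_attained by blast
      then have "exp (l * n * W \<omega>) = exp (l * \<bar>S c \<omega>\<bar>)" using n by simp
      also have "\<dots> \<le> (\<Sum>c\<in>C. exp (l * \<bar>S c \<omega>\<bar>))"
        using c C by (intro member_le_sum) auto
      finally show ?thesis .
    qed
    have "(\<integral>\<^sup>+\<omega>. ennreal (exp (l * n * W \<omega>)) \<partial>M) \<le> (\<integral>\<^sup>+\<omega>. (\<Sum>c\<in>C. ennreal (exp (l * \<bar>S c \<omega>\<bar>))) \<partial>M)"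
      using exp_W by (intro nn_integral_mono) (simp add: sum_ennreal ennreal_leI)
    also have "\<dots> = (\<Sum>c\<in>C. \<integral>\<^sup>+\<omega>. ennreal (exp (l * \<bar>S c \<omega>\<bar>)) \<partial>M)"
      by (intro nn_integral_sum) auto
    also have "\<dots> \<le> (\<Sum>c\<in>C. ennreal (2 * exp (l\<^sup>2 * (4 * n * B\<^sup>2) / 8)))"
    proof (intro sum_mono)
      fix c assume c: "c \<in> C"
      from Hoeffding_ineq.nn_integral_exp_abs_sum_le[OF Hoeff[OF c] l]
      show "(\<integral>\<^sup>+\<omega>. ennreal (exp (l * \<bar>S c \<omega>\<bar>)) \<partial>M) \<le> ennreal (2 * exp (l\<^sup>2 * (4 * n * B\<^sup>2) / 8))"
        unfolding mean[OF c] var S_def .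
    qed
    also have "\<dots> = ennreal A"
      by (subst sum_ennreal) (simp_all add: A_def K_def)
    finally have nn: "(\<integral>\<^sup>+\<omega>. ennreal (exp (l * n * W \<omega>)) \<partial>M) \<le> ennreal A" .
    have int: "integrable M (\<lambda>\<omega>. exp (l * n * W \<omega>))"
      by (intro integrableI_nonneg le_less_trans[OF nn]) auto
    have EA: "expectation (\<lambda>\<omega>. exp (l * n * W \<omega>)) \<le> A"
      using nn A by (subst (asm) nn_integral_eq_integral[OF int]) auto
    \<comment> \<open>The tangent inequality \<open>ln v \<le> v - 1\<close> replaces Jensen's
      inequality: the exponential divided by \<open>A\<close> has mean at most 1, so integration
      leaves \<open>ln A\<close>.\<close>
    have "l * n * W \<omega> \<le> exp (l * n * W \<omega>) / A - 1 + ln A" for \<omega>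
    proof -
      have "ln (exp (l * n * W \<omega>) / A) \<le> exp (l * n * W \<omega>) / A - 1"
        using A by (intro ln_le_minus_one) auto
      then show ?thesis using A by (simp add: ln_div)
    qed
    then have "expectation (\<lambda>\<omega>. l * n * W \<omega>) \<le> expectation (\<lambda>\<omega>. exp (l * n * W \<omega>) / A - 1 + ln A)"
      using \<open>integrable M W\<close> int by (intro integral_mono) auto
    also have "\<dots> = expectation (\<lambda>\<omega>. exp (l * n * W \<omega>)) / A - 1 + ln A"
      using int by (simp add: prob_space)
    also have "\<dots> \<le> ln A" using EA A by simp
    also have "ln A = ln (2 * K) + l\<^sup>2 * n * B\<^sup>2 / 2"
      using K by (simp add: A_def ln_mult)
    also have "\<dots> = n * \<alpha>\<^sup>2 / B\<^sup>2"
      using \<alpha>2 B by (simp add: l_def power_divide field_simps)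
    also have "\<dots> = l * n * \<alpha>" by (simp add: l_def power2_eq_square)
    finally show ?thesis using l n by simp
  qed

  fix u :: real assume u: "0 \<le> u"
  let ?v = "n * (\<alpha> + u)"
  have sub: "{\<omega> \<in> space M. \<alpha> + u \<le> W \<omega>} \<subseteq> (\<Union>c\<in>C. {\<omega> \<in> space M. ?v \<le> \<bar>S c \<omega>\<bar>})"
  proof
    fix \<omega> assume \<omega>: "\<omega> \<in> {\<omega> \<in> space M. \<alpha> + u \<le> W \<omega>}"
    obtain c where c: "c \<in> C" "W \<omega> = \<bar>S c \<omega>\<bar> / n" using W_attained by blast
    with \<omega> n show "\<omega> \<in> (\<Union>c\<in>C. {\<omega> \<in> space M. ?v \<le> \<bar>S c \<omega>\<bar>})"
      by (auto simp: field_simps intro!: bexI[of _ c])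
  qed
  have "prob {\<omega> \<in> space M. \<alpha> + u \<le> W \<omega>} \<le> prob (\<Union>c\<in>C. {\<omega> \<in> space M. ?v \<le> \<bar>S c \<omega>\<bar>})"
    using C by (intro finite_measure_mono sub) auto
  also have "\<dots> \<le> (\<Sum>c\<in>C. prob {\<omega> \<in> space M. ?v \<le> \<bar>S c \<omega>\<bar>})"
    using C by (intro finite_measure_subadditive_finite) auto
  also have "\<dots> \<le> (\<Sum>c\<in>C. 2 * exp (- 2 * ?v\<^sup>2 / (4 * n * B\<^sup>2)))"
  proof (intro sum_mono)
    fix c assume c: "c \<in> C"
    have "0 \<le> ?v" "0 < (\<Sum>k\<in>J. (B - - B)\<^sup>2)" unfolding var using n \<alpha>0 u B by simp_all
    from Hoeffding_ineq.Hoeffding_ineq_abs_ge[OF Hoeff[OF c] this]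
    show "prob {\<omega> \<in> space M. ?v \<le> \<bar>S c \<omega>\<bar>} \<le> 2 * exp (- 2 * ?v\<^sup>2 / (4 * n * B\<^sup>2))"
      unfolding mean[OF c] var S_def .
  qed
  also have "\<dots> = 2 * K * exp (- (n * (\<alpha> + u)\<^sup>2 / (2 * B\<^sup>2)))"
    using n by (simp add: K_def power_mult_distrib power2_eq_square[of n])
  also have "\<dots> \<le> 2 * K * exp (- (ln (2 * K) + n * u\<^sup>2 / (2 * B\<^sup>2)))"
  proof -
    \<comment> \<open>Dropping the nonnegative cross term separates the part in
      \<open>\<alpha>\<close>, which becomes \<open>ln (2 * K)\<close>, from the tail in
      \<open>u\<close>.\<close>
    have "n * \<alpha>\<^sup>2 + n * u\<^sup>2 \<le> n * (\<alpha> + u)\<^sup>2"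
      using n \<alpha>0 u by (simp add: power2_sum distrib_left)
    then have "(n * \<alpha>\<^sup>2 + n * u\<^sup>2) / (2 * B\<^sup>2) \<le> n * (\<alpha> + u)\<^sup>2 / (2 * B\<^sup>2)"
      by (intro divide_right_mono) auto
    then have "ln (2 * K) + n * u\<^sup>2 / (2 * B\<^sup>2) \<le> n * (\<alpha> + u)\<^sup>2 / (2 * B\<^sup>2)"
      unfolding \<alpha>2 using B by (simp add: add_divide_distrib)
    then show ?thesis using K by simp
  qed
  also have "\<dots> = exp (- (n * u\<^sup>2 / (2 * B\<^sup>2)))"
    using K by (simp add: exp_minus exp_diff field_simps)
  finally show "prob {\<omega> \<in> space M. \<alpha> + u \<le> W \<omega>} \<le> exp (- (real (card J) * u\<^sup>2 / (2 * B\<^sup>2)))"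
    by (simp add: n_def)
qed

subsection \<open>Nets of a cube and the resulting rate\<close>

text \<open>After the rigid motion is undone, two points of one cell differ by at most
  \<open>D / \<nu>\<close> in each coordinate. The net consists of points of \<open>X\<close>, not
  of cell centres, because \<open>F\<close> is controlled on \<open>X\<close> only.\<close>

lemma cube_finite_net:
  fixes X K :: "(real ^ 'p) set"
  assumes K: "is_cube K D" "X \<subseteq> K" and \<nu>: "0 < \<nu>"
  obtains C where "finite C" "C \<subseteq> X" "card C \<le> \<nu> ^ CARD('p)"
    and "\<And>x. x \<in> X \<Longrightarrow> \<exists>c\<in>C. norm (x - c) \<le> D * sqrt (real CARD('p)) / real \<nu>"
proof -
  obtain c :: "real ^ 'p" and Q :: "real ^ 'p \<Rightarrow> real ^ 'p" where Q: "orthogonal_transformation Q"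
    and KQ: "K = (\<lambda>y. c + Q y) ` cbox 0 (\<chi> i::'p. D)"
    using K(1) unfolding is_cube_def by blast
  have "\<forall>x\<in>X. \<exists>y\<in>cbox 0 (\<chi> i. D). x = c + Q y" using K(2) unfolding KQ by blast
  then obtain y where y: "\<And>x. x \<in> X \<Longrightarrow> y x \<in> cbox 0 (\<chi> i. D)"
    and xy: "\<And>x. x \<in> X \<Longrightarrow> x = c + Q (y x)" by metis
  have y_bounds: "0 \<le> y x $ i" "y x $ i \<le> D" if "x \<in> X" for x i
    using y[OF that] by (auto simp: mem_box_cart)
  define t where "t x i = real \<nu> * (y x $ i) / D" for x i
  \<comment> \<open>The \<open>min\<close> puts points on a far face, where
    \<open>t x i = \<nu>\<close>, into the last cell instead of opening an extra one.\<close>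
  define cell where "cell x = (\<lambda>i\<in>UNIV. min (\<nu> - 1) (nat \<lfloor>t x i\<rfloor>))" for x
  have cell_range: "cell ` X \<subseteq> (UNIV :: 'p set) \<rightarrow>\<^sub>E {..<\<nu>}"
    using \<nu> by (auto simp: cell_def min_less_iff_disj)
  have fin: "finite (cell ` X)"
    using cell_range by (rule finite_subset) (simp add: finite_PiE)
  have card_cell: "card (cell ` X) \<le> \<nu> ^ CARD('p)"
    using card_mono[OF _ cell_range] by (simp add: finite_PiE card_PiE)
  have close: "norm (x - x') \<le> D * sqrt (real CARD('p)) / real \<nu>"
    if x: "x \<in> X" "x' \<in> X" and eq: "cell x = cell x'" for x x'
  proof -
    have D0: "0 \<le> D" using y_bounds[OF x(1)] order_trans by blast
    have comp: "norm ((y x - y x') $ i) \<le> norm ((\<chi> i. D / real \<nu>) $ i)" for i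
    \<comment> \<open>For \<open>D = 0\<close> the division makes \<open>t\<close> vanish
      identically; that case is read off the coordinates, which are all 0.\<close>
    proof (cases "D = 0")
      case True
      then show ?thesis using y_bounds[OF x(1), of i] y_bounds[OF x(2), of i] by simp
    next
      case False
      have t01: "0 \<le> t x i" "t x i \<le> real \<nu>" "0 \<le> t x' i" "t x' i \<le> real \<nu>"
        using y_bounds[OF x(1), of i] y_bounds[OF x(2), of i] False D0
          mult_left_mono[OF y_bounds(2)[OF x(1)], of "real \<nu>" i]
          mult_left_mono[OF y_bounds(2)[OF x(2)], of "real \<nu>" i]
        by (auto simp: t_def field_simps)
      have cellb: "real (cell z i) \<le> t z i \<and> t z i \<le> real (cell z i) + 1"
        if "0 \<le> t z i" "t z i \<le> real \<nu>" for z
        using that \<nu> unfolding cell_def by (simp add: min_def of_nat_diff) linarith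
      have "\<bar>t x i - t x' i\<bar> \<le> 1"
        using cellb[of x] cellb[of x'] t01 eq by (simp add: abs_le_iff)
      then have "\<bar>t x i - t x' i\<bar> * (D / real \<nu>) \<le> 1 * (D / real \<nu>)"
        using D0 by (intro mult_right_mono) auto
      moreover have "\<bar>t x i - t x' i\<bar> * (D / real \<nu>) = \<bar>y x $ i - y x' $ i\<bar>"
      proof -
        have "(t x i - t x' i) * (D / real \<nu>) = y x $ i - y x' $ i"
          using False \<nu> by (simp add: t_def field_simps)
        then show ?thesis using D0 by (metis abs_mult abs_of_nonneg divide_nonneg_nonneg of_nat_0_le_iff)
      qed
      ultimately show ?thesis using D0 by simp
    qed
    have "x - x' = Q (y x - y x')"
      using xy[OF x(1)] xy[OF x(2)] orthogonal_transformation_linear[OF Q]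
      by (metis add_diff_cancel_left linear_diff)
    then have "norm (x - x') = norm (y x - y x')" using orthogonal_transformation_norm[OF Q] by simp
    also have "\<dots> \<le> norm (\<chi> i::'p. D / real \<nu>)" by (intro norm_le_componentwise_cart comp)
    also have "\<dots> = D * sqrt (real CARD('p)) / real \<nu>"
      using D0 by (simp add: norm_vec_def L2_set_def real_sqrt_mult power_divide real_sqrt_divide)
    finally show ?thesis .
  qed
  \<comment> \<open>One representative in \<open>X\<close> for each occupied cell.\<close>
  define C where "C = inv_into X cell ` cell ` X"
  show thesis
  proof (rule that[of C])
    show "finite C" unfolding C_def using fin by simp
    show "C \<subseteq> X" unfolding C_def by (auto intro: inv_into_into)
    show "card C \<le> \<nu> ^ CARD('p)"
      unfolding C_def using card_image_le[OF fin] card_cell by (rule order_trans)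
    fix x assume x: "x \<in> X"
    then have "inv_into X cell (cell x) \<in> X" "cell (inv_into X cell (cell x)) = cell x"
      by (auto intro: inv_into_into f_inv_into_f)
    then show "\<exists>c\<in>C. norm (x - c) \<le> D * sqrt (real CARD('p)) / real \<nu>"
      using x close[of x "inv_into X cell (cell x)"] unfolding C_def by force
  qed
qed

text \<open>The inequality \<open>ln u \<le> u - 1\<close> at \<open>u = x powr s / exp 1\<close>.
  Its \<open>exp 1\<close> is the one that appears in \<open>rate_const\<close>.\<close>

lemma ln_le_powr_div:
  fixes x s :: real
  assumes "0 < x" "0 < s"
  shows "ln x \<le> x powr s / (s * exp 1)"
proof -
  have "ln (x powr s / exp 1) \<le> x powr s / exp 1 - 1"
    using assms by (intro ln_le_minus_one) auto
  then have "s * ln x \<le> x powr s / exp 1"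
    using assms by (simp add: ln_div ln_powr)
  then show ?thesis using assms by (simp add: field_simps)
qed

text \<open>The cost of rounding \<open>\<nu>\<close> up to an integer: \<open>ln \<nu>\<close> grows by a factor of at most 4, hence its
  square root by at most 2, which the factor 2 in front of the rate constant absorbs.\<close>

lemma nat_ceiling_root_le_pow4:
  assumes n: "0 < n" and \<gamma>: "0 < \<gamma>" "\<gamma> \<le> 1"
  shows "real (nat \<lceil>real n powr (1 / (2 * \<gamma>))\<rceil>) \<le> (real n powr (1 / (2 * \<gamma>))) ^ 4"
proof (cases "n = 1")
  case False
  define y where "y = real n powr (1 / (2 * \<gamma>))"
  have n2: "2 \<le> real n" using n False by simp
  \<comment> \<open>From \<gamma> \<le> 1 and \<open>n \<ge> 2\<close> one gets
    \<open>y\<^sup>2 \<ge> 2\<close>, which leaves room in \<open>y ^ 4\<close> for the rounding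
    error 1.\<close>
  have "real n powr (1 / 2) \<le> y"
    unfolding y_def using n2 \<gamma> by (intro powr_mono) (auto simp: field_simps)
  then have sq: "sqrt (real n) \<le> y" by (simp add: powr_half_sqrt)
  then have "(sqrt (real n))\<^sup>2 \<le> y\<^sup>2" by (intro power_mono) auto
  then have y2: "2 \<le> y\<^sup>2" using n2 by simp
  have y1: "1 \<le> y" using sq n2 by (meson le_numeral_extra(4) one_le_numeral order_trans real_sqrt_ge_one)
  have "y \<le> y\<^sup>2" using y1 by (simp add: self_le_power)
  moreover have "2 * y\<^sup>2 \<le> y\<^sup>2 * y\<^sup>2" using y2 by (intro mult_right_mono) auto
  moreover have "y\<^sup>2 * y\<^sup>2 = y ^ 4" by (simp flip: power_add)
  ultimately have "y + 1 \<le> y ^ 4" using y2 by linarith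
  then show ?thesis unfolding y_def[symmetric] using y1 by linarith
qed auto

text \<open>The choice of \<nu> makes the mesh term of order \<open>n powr (- 1 / 2)\<close>. The
  logarithm of the number of cells grows like \<open>ln n\<close> and is traded for
  \<open>n powr (1 - 2 * lam)\<close>, so that after division by \<open>n\<close> its root has order
  \<open>n powr (- lam)\<close>.\<close>

lemma net_error_le_rate_const:
  fixes L D B \<gamma> lam :: real and n p K :: nat
  assumes n: "0 < n" and p: "0 < p" and \<gamma>: "0 < \<gamma>" "\<gamma> \<le> 1" and lam: "0 < lam" "lam < 1 / 2"
    and L: "0 \<le> L" and D: "0 \<le> D" and B: "0 < B"
    and K: "0 < K" "K \<le> (nat \<lceil>real n powr (1 / (2 * \<gamma>))\<rceil>) ^ p"
  shows "2 * (L * (D * sqrt (real p) / real (nat \<lceil>real n powr (1 / (2 * \<gamma>))\<rceil>)) powr \<gamma>)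
           + B * sqrt (2 * ln (2 * real K) / real n)
         \<le> 2 * rate_const p L D B \<gamma> lam / real n powr lam"
proof -
  define x where "x = real n"
  define y where "y = x powr (1 / (2 * \<gamma>))"
  define \<nu> where "\<nu> = nat \<lceil>y\<rceil>"
  \<comment> \<open>With this exponent the bound on \<open>ln x\<close>, divided by
    \<open>x\<close>, is a multiple of \<open>z\<^sup>2\<close>, the square of the target
    rate.\<close>
  define s where "s = 1 - 2 * lam"
  define z where "z = x powr (- lam)"
  have x1: "1 \<le> x" using n by (simp add: x_def)
  have s: "0 < s" using lam by (simp add: s_def)
  have z0: "0 \<le> z" by (simp add: z_def)
  have y1: "1 \<le> y" unfolding y_def using x1 \<gamma> by (intro ge_one_powr_ge_zero) auto
  have \<nu>y: "y \<le> real \<nu>" unfolding \<nu>_def using y1 by linarith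
  have half_z: "x powr (- (1 / 2)) \<le> z"
    unfolding z_def using x1 lam by (intro powr_mono) auto
  have mesh: "(D * sqrt (real p) / real \<nu>) powr \<gamma> \<le> D powr \<gamma> * real p powr (\<gamma> / 2) * z"
  proof -
    have "(D * sqrt (real p) / real \<nu>) powr \<gamma> \<le> (D * sqrt (real p) / y) powr \<gamma>"
      using D y1 \<nu>y \<gamma> by (intro powr_mono2 divide_left_mono) auto
    also have "\<dots> = D powr \<gamma> * sqrt (real p) powr \<gamma> / y powr \<gamma>"
      using D y1 by (simp add: powr_divide powr_mult)
    also have "sqrt (real p) powr \<gamma> = real p powr (\<gamma> / 2)"
      by (simp add: powr_half_sqrt[symmetric] powr_powr)
    also have "y powr \<gamma> = x powr (1 / 2)"
      using \<gamma> by (simp add: y_def powr_powr)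
    also have "D powr \<gamma> * real p powr (\<gamma> / 2) / x powr (1 / 2)
        = D powr \<gamma> * real p powr (\<gamma> / 2) * x powr (- (1 / 2))"
      by (simp add: powr_minus_divide)
    also have "\<dots> \<le> D powr \<gamma> * real p powr (\<gamma> / 2) * z"
      using half_z by (intro mult_left_mono) auto
    finally show ?thesis .
  qed
  have "ln (2 * real K) \<le> ln (2 * real \<nu> ^ p)"
  proof -
    have "real K \<le> real (\<nu> ^ p)" using K(2) unfolding \<nu>_def y_def x_def by (rule of_nat_mono)
    then show ?thesis using K(1) by (intro ln_mono) auto
  qed
  also have "\<dots> = ln 2 + p * ln (real \<nu>)"
    using \<nu>y y1 by (simp add: ln_mult ln_realpow)
  also have "\<dots> \<le> ln 2 + p * (2 / \<gamma> * ln x)"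
  proof -
    have "real \<nu> \<le> y ^ 4"
      using nat_ceiling_root_le_pow4[OF n \<gamma>] by (simp add: \<nu>_def y_def x_def)
    then have "ln (real \<nu>) \<le> ln (y ^ 4)" using \<nu>y y1 by (intro ln_mono) auto
    also have "\<dots> = 2 / \<gamma> * ln x" using y1 x1 by (simp add: ln_realpow y_def ln_powr)
    finally show ?thesis by (intro add_left_mono mult_left_mono) auto
  qed
  also have "\<dots> \<le> ln 2 + p * (2 / \<gamma> * (x powr s / (s * exp 1)))"
    using ln_le_powr_div[of x s] x1 s \<gamma> by (intro add_left_mono mult_left_mono) auto
  finally have lnK: "ln (2 * real K) \<le> ln 2 + p * (2 / \<gamma> * (x powr s / (s * exp 1)))" .
  have xs: "x powr s / x = z\<^sup>2"
  proof -
    have "x powr s / x = x powr (s - 1)" using x1 by (simp add: powr_diff)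
    also have "\<dots> = x powr (- lam + - lam)" by (simp add: s_def)
    also have "\<dots> = z\<^sup>2" unfolding powr_add z_def power2_eq_square ..
    finally show ?thesis .
  qed
  \<comment> \<open>The last summand of \<open>rate_const\<close> divided by \<open>B\<close>. The 2
    in \<open>2 * R * z\<close> is the square root of the factor 4 spent on rounding.\<close>
  define R where "R = sqrt (real p) / sqrt (\<gamma> * s * exp 1)"
  have R2: "R\<^sup>2 = real p / (\<gamma> * s * exp 1)"
    using \<gamma> s by (simp add: R_def power_divide)
  have R0: "0 \<le> R" by (simp add: R_def \<gamma> s less_imp_le)
  have "2 * ln (2 * real K) / x \<le> 2 * (ln 2 + p * (2 / \<gamma> * (x powr s / (s * exp 1)))) / x"
    using lnK x1 by (intro divide_right_mono) auto
  also have "\<dots> = 2 * ln 2 / x + 4 * (real p / (\<gamma> * s * exp 1)) * (x powr s / x)"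
    by (simp add: add_divide_distrib distrib_left)
  also have "\<dots> = 2 * ln 2 / x + (2 * R * z)\<^sup>2"
    unfolding xs R2[symmetric] by (simp add: power_mult_distrib)
  finally have "sqrt (2 * ln (2 * real K) / x) \<le> sqrt (2 * ln 2 / x + (2 * R * z)\<^sup>2)"
    by (rule real_sqrt_le_mono)
  also have "\<dots> \<le> sqrt (2 * ln 2 / x) + sqrt ((2 * R * z)\<^sup>2)"
    using x1 by (intro sqrt_add_le_add_sqrt) auto
  also have "\<dots> = sqrt (2 * ln 2) * x powr (- (1 / 2)) + 2 * R * z"
    using R0 z0 x1 by (simp add: real_sqrt_divide powr_minus_divide powr_half_sqrt)
  also have "\<dots> \<le> sqrt (2 * ln 2) * z + 2 * R * z"
    using half_z by (intro add_right_mono mult_left_mono) auto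
  finally have dev: "sqrt (2 * ln (2 * real K) / x) \<le> (sqrt (2 * ln 2) + 2 * R) * z"
    by (simp add: distrib_right)
  have "2 * (L * (D * sqrt (real p) / real \<nu>) powr \<gamma>) + B * sqrt (2 * ln (2 * real K) / x)
      \<le> 2 * (L * (D powr \<gamma> * real p powr (\<gamma> / 2) * z)) + B * ((sqrt (2 * ln 2) + 2 * R) * z)"
    using mesh dev L B by (intro add_mono mult_left_mono) auto
  \<comment> \<open>The term with \<open>sqrt (2 * ln 2)\<close> occurs once; doubling it lets a
    common factor 2 be pulled out.\<close>
  also have "\<dots> \<le> 2 * (L * (D powr \<gamma> * real p powr (\<gamma> / 2) * z)) + B * ((2 * sqrt (2 * ln 2) + 2 * R) * z)"
    using B z0 by (intro add_left_mono mult_left_mono mult_right_mono) auto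
  also have "\<dots> = 2 * rate_const p L D B \<gamma> lam * z"
    unfolding rate_const_def R_def s_def by (simp add: powr_half_sqrt algebra_simps)
  also have "\<dots> = 2 * rate_const p L D B \<gamma> lam / x powr lam"
    using x1 by (simp add: z_def powr_minus_divide)
  finally show ?thesis unfolding \<nu>_def y_def x_def .
qed

lemma is_cube_nonneg_edge:
  fixes K :: "(real ^ 'p) set"
  assumes "is_cube K D" "K \<noteq> {}"
  shows "0 \<le> D"
proof -
  have "cbox 0 (\<chi> i::'p. D) \<noteq> {}" using assms unfolding is_cube_def by auto
  then obtain y :: "real ^ 'p" where "y \<in> cbox 0 (\<chi> i. D)" by blast
  then have "0 \<le> y $ undefined" "y $ undefined \<le> D" by (auto simp: mem_box_cart)
  then show ?thesis by linarith
qed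

subsection \<open>Sample average errors\<close>

lemma eps_argmin_nonempty:
  assumes "X \<noteq> {}" "bdd_below (g ` X)" "0 < \<epsilon>"
  shows "eps_argmin X g \<epsilon> \<noteq> {}"
proof -
  have "\<exists>x\<in>X. g x < (INF x\<in>X. g x) + \<epsilon>"
    using cINF_less_iff[OF assms(1,2), of "(INF x\<in>X. g x) + \<epsilon>"] assms(3) by simp
  then show ?thesis by (force simp: eps_argmin_def)
qed

lemma pess_dist_le:
  assumes "A \<noteq> {}" and "\<And>a. a \<in> A \<Longrightarrow> \<exists>b\<in>B. norm (a - b) \<le> r"
  shows "pess_dist A B \<le> r"
  unfolding pess_dist_def
proof (rule cSUP_least[OF assms(1)])
  fix a assume "a \<in> A"
  then obtain b where b: "b \<in> B" "norm (a - b) \<le> r" using assms(2) by blast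
  have "bdd_below ((\<lambda>b. norm (a - b)) ` B)" by (rule bdd_belowI2[of _ 0]) simp
  from cINF_lower[OF this b(1)] b(2) show "(INF b\<in>B. norm (a - b)) \<le> r" by linarith
qed

lemma convex_on_saa_obj:
  assumes "\<And>j. j \<in> {1..n} \<Longrightarrow> convex_on X (\<lambda>x. F x (\<zeta> j))" and "convex X"
  shows "convex_on X (saa_obj F n \<zeta>)"
proof -
  have "convex_on X (\<lambda>x. \<Sum>j\<in>J. F x (\<zeta> j))" if "finite J" "J \<subseteq> {1..n}" for J
    using that
  proof (induction J rule: finite_induct)
    case empty
    then show ?case using assms(2) by (simp add: convex_on_const)
  next
    case (insert j J)
    then show ?case using assms(1)[of j] by (auto intro: convex_on_add)
  qed
  then show ?thesis
    unfolding saa_obj_def[abs_def] by (intro convex_on_cmul) auto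
qed

lemma abs_saa_obj_le:
  assumes "\<And>j. j \<in> {1..n} \<Longrightarrow> \<bar>F x (\<zeta> j)\<bar> \<le> B" and "0 < n"
  shows "\<bar>saa_obj F n \<zeta> x\<bar> \<le> B"
proof -
  have "\<bar>\<Sum>j=1..n. F x (\<zeta> j)\<bar> \<le> (\<Sum>j=1..n. B)"
    using assms(1) by (intro order_trans[OF sum_abs] sum_mono)
  then show ?thesis using assms(2) by (simp add: saa_obj_def abs_mult field_simps)
qed

text \<open>Turns a replication back into a block of the whole sample, for which independence and
  the common distribution are available.\<close>

lemma saa_obj_replication:
  assumes "0 < i"
  shows "saa_obj F n (replication n z i) x
    = (\<Sum>k\<in>{(i - 1) * n + 1..(i - 1) * n + n}. F x (z k)) / real n"
proof -
  have "(\<Sum>k\<in>{(i - 1) * n + 1..(i - 1) * n + n}. F x (z k)) = (\<Sum>j=1..n. F x (z ((i - 1) * n + j)))"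
    using sum.shift_bounds_cl_nat_ivl[of "\<lambda>k. F x (z k)" 1 "(i - 1) * n" n] by (simp add: add.commute)
  then show ?thesis by (simp add: saa_obj_def replication_def)
qed

lemma replication_index:
  fixes i j m n :: nat
  assumes "i \<in> {1..m}" "j \<in> {1..n}"
  shows "(i - 1) * n + j \<in> {1..m * n}"
proof -
  have "(i - 1) * n + j \<le> (i - 1) * n + 1 * n" using assms by (intro add_left_mono) simp
  also have "\<dots> = i * n" using assms by (cases i) auto
  also have "\<dots> \<le> m * n" using assms by simp
  finally show ?thesis using assms by simp
qed

text \<open>Each \<open>a k\<close> occurs \<open>m - 1\<close> times as first and
  \<open>m - 1\<close> times as second member of an ordered pair.\<close>

lemma sum_off_diagonal_pairs:
  fixes a :: "nat \<Rightarrow> real"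
  assumes "0 < m"
  shows "(\<Sum>i=1..m. \<Sum>j\<in>{1..m} - {i}. a i + a j) = 2 * (real m - 1) * (\<Sum>i=1..m. a i)"
proof -
  have "(\<Sum>j\<in>{1..m} - {i}. a i + a j) = (real m - 1) * a i + ((\<Sum>j=1..m. a j) - a i)"
    if "i \<in> {1..m}" for i
  proof -
    have "(\<Sum>j\<in>{1..m} - {i}. a j) = (\<Sum>j=1..m. a j) - a i"
      using that by (simp add: sum_diff1)
    moreover have "real (card ({1..m} - {i})) = real m - 1"
      using that assms by (simp add: of_nat_diff)
    ultimately show ?thesis by (simp add: sum.distrib)
  qed
  then have "(\<Sum>i=1..m. \<Sum>j\<in>{1..m} - {i}. a i + a j)
      = (\<Sum>i=1..m. (real m - 1) * a i + ((\<Sum>j=1..m. a j) - a i))" by simp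
  also have "\<dots> = (real m - 1) * (\<Sum>i=1..m. a i) + (real m * (\<Sum>j=1..m. a j) - (\<Sum>i=1..m. a i))"
    by (simp add: sum.distrib sum_subtractf sum_distrib_left)
  also have "\<dots> = 2 * (real m - 1) * (\<Sum>i=1..m. a i)" by (simp add: algebra_simps)
  finally show ?thesis .
qed

text \<open>Provides a measurable stand-in \<open>V\<close> for the supremum of the error over
  \<open>X\<close>, so that the measurability of that supremum is never at issue. It is
  \<open>2 * h + W\<close>: moving to the nearest net point costs \<open>h\<close> in the sample
  average and \<open>h\<close> in the true objective, and \<open>W\<close> is the maximal deviation
  on the net.\<close>

lemma (in prob_space) sample_error_majorant:
  fixes X :: "(real ^ 'p) set" and F :: "real ^ 'p \<Rightarrow> 'b \<Rightarrow> real" and Y :: "'k \<Rightarrow> 'a \<Rightarrow> 'b"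
  assumes cube: "is_cube K D" "X \<subseteq> K" and X: "X \<noteq> {}"
    and J: "finite J" "J \<noteq> {}"
    and indep: "indep_vars (\<lambda>_. N) Y J"
    and distr: "\<And>k. k \<in> J \<Longrightarrow> distr M N (Y k) = distr P N \<xi>"
    and \<xi>: "\<xi> \<in> P \<rightarrow>\<^sub>M N" and P: "prob_space P"
    and F: "\<And>x. x \<in> X \<Longrightarrow> F x \<in> borel_measurable N"
    and FB: "\<And>x z. x \<in> X \<Longrightarrow> z \<in> space N \<Longrightarrow> \<bar>F x z\<bar> \<le> B" and B: "0 < B"
    and Hoelder: "\<And>x y z. x \<in> X \<Longrightarrow> y \<in> X \<Longrightarrow> z \<in> space N \<Longrightarrow>
                    \<bar>F x z - F y z\<bar> \<le> L * norm (x - y) powr \<gamma>" and L: "0 \<le> L"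
    and \<gamma>: "0 < \<gamma>" "\<gamma> \<le> 1" and lam: "0 < lam" "lam < 1 / 2"
  defines "\<beta> \<equiv> 2 * rate_const CARD('p) L D B \<gamma> lam / real (card J) powr lam"
  obtains V where "integrable M V" and "\<And>\<omega>. 0 \<le> V \<omega>"
    and "\<And>x \<omega>. x \<in> X \<Longrightarrow> \<omega> \<in> space M \<Longrightarrow>
           \<bar>(\<Sum>k\<in>J. F x (Y k \<omega>)) / real (card J) - true_obj P \<xi> F x\<bar> \<le> V \<omega>"
    and "expectation V \<le> \<beta>"
    and "\<And>u. 0 \<le> u \<Longrightarrow>
           prob {\<omega> \<in> space M. \<beta> + u \<le> V \<omega>} \<le> exp (- (real (card J) * u\<^sup>2 / (2 * B\<^sup>2)))"
proof -
  define n where "n = card J"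
  define \<nu> where "\<nu> = nat \<lceil>real n powr (1 / (2 * \<gamma>))\<rceil>"
  define r where "r = D * sqrt (real CARD('p)) / real \<nu>"
  define h where "h = L * r powr \<gamma>"
  let ?f = "true_obj P \<xi> F"
  have n: "0 < n" using J by (simp add: n_def card_gt_0_iff)
  then have \<nu>: "0 < \<nu>" by (simp add: \<nu>_def)
  have D: "0 \<le> D" using is_cube_nonneg_edge cube X by blast
  have h0: "0 \<le> h" using L by (simp add: h_def)
  obtain C where C: "finite C" "C \<subseteq> X" "card C \<le> \<nu> ^ CARD('p)"
    and net: "\<And>x. x \<in> X \<Longrightarrow> \<exists>c\<in>C. norm (x - c) \<le> r"
    using cube_finite_net[OF cube \<nu>] unfolding r_def by metis
  have C_ne: "C \<noteq> {}" using net X by blast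
  have f_distr: "?f x = (\<integral>z. F x z \<partial>distr P N \<xi>)" if "x \<in> X" for x
    unfolding true_obj_def by (rule integral_distr[symmetric, OF \<xi> F[OF that]])
  define \<alpha> where "\<alpha> = B * sqrt (2 * ln (2 * real (card C)) / real n)"
  define W where "W \<omega> = (MAX c\<in>C. \<bar>(\<Sum>k\<in>J. F c (Y k \<omega>)) / real n - (\<integral>z. F c z \<partial>distr P N \<xi>)\<bar>)" for \<omega>
  have FC: "F c \<in> borel_measurable N" "z \<in> space N \<Longrightarrow> \<bar>F c z\<bar> \<le> B" if "c \<in> C" for c z
    using F FB C(2) that by auto
  note class_dev = finite_class_deviation[where g = F and N = N and Y = Y and Q = "distr P N \<xi>",
      OF C(1) C_ne J B indep, folded n_def, folded W_def \<alpha>_def]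
  have W_int: "integrable M W" by (rule class_dev(1)) (use distr FC in auto)
  have W_exp: "expectation W \<le> \<alpha>" by (rule class_dev(2)) (use distr FC in auto)
  have W_tail: "prob {\<omega> \<in> space M. \<alpha> + u \<le> W \<omega>} \<le> exp (- (real n * u\<^sup>2 / (2 * B\<^sup>2)))"
    if "0 \<le> u" for u
    by (rule class_dev(3)) (use distr FC that in auto)
  have rate: "2 * h + \<alpha> \<le> \<beta>"
    unfolding \<alpha>_def \<beta>_def h_def r_def \<nu>_def n_def
    by (rule net_error_le_rate_const)
       (use n \<gamma> lam L D B C C_ne in \<open>auto simp: n_def \<nu>_def card_gt_0_iff\<close>)
  have Hoelder_r: "\<bar>F x z - F c z\<bar> \<le> h" if "x \<in> X" "c \<in> X" "z \<in> space N" "norm (x - c) \<le> r" for x c z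
  proof -
    have "\<bar>F x z - F c z\<bar> \<le> L * norm (x - c) powr \<gamma>" using Hoelder that by blast
    also have "\<dots> \<le> h" unfolding h_def using L \<gamma> that by (intro mult_left_mono powr_mono2) auto
    finally show ?thesis .
  qed
  have W_ge: "\<bar>(\<Sum>k\<in>J. F c (Y k \<omega>)) / real (card J) - ?f c\<bar> \<le> W \<omega>" if "c \<in> C" for c \<omega>
  proof -
    have "c \<in> X" using that C by blast
    then show ?thesis
      unfolding W_def n_def f_distr[OF \<open>c \<in> X\<close>] using C that by (intro Max_ge) auto
  qed
  have W0: "0 \<le> W \<omega>" for \<omega> using C_ne W_ge order_trans[OF abs_ge_zero] by blast
  show thesis
  proof (rule that[of "\<lambda>\<omega>. 2 * h + W \<omega>"])
    show "integrable M (\<lambda>\<omega>. 2 * h + W \<omega>)" using W_int by simp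
    show "0 \<le> 2 * h + W \<omega>" for \<omega> using h0 W0[of \<omega>] by simp
    show "expectation (\<lambda>\<omega>. 2 * h + W \<omega>) \<le> \<beta>"
      using W_int W_exp rate by (simp add: prob_space)
    show "prob {\<omega> \<in> space M. \<beta> + u \<le> 2 * h + W \<omega>} \<le> exp (- (real (card J) * u\<^sup>2 / (2 * B\<^sup>2)))"
      if "0 \<le> u" for u
    proof -
      \<comment> \<open>By \<open>rate\<close>, exceeding \<open>\<beta> + u\<close> forces
        \<open>W\<close> to exceed \<open>\<alpha> + u\<close>.\<close>
      have "prob {\<omega> \<in> space M. \<beta> + u \<le> 2 * h + W \<omega>} \<le> prob {\<omega> \<in> space M. \<alpha> + u \<le> W \<omega>}"
        using W_int rate by (intro finite_measure_mono) auto
      also have "\<dots> \<le> exp (- (real n * u\<^sup>2 / (2 * B\<^sup>2)))" by (rule W_tail[OF that])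
      finally show ?thesis by (simp add: n_def)
    qed
    fix x \<omega> assume x: "x \<in> X" and \<omega>: "\<omega> \<in> space M"
    obtain c where c: "c \<in> C" "norm (x - c) \<le> r" using net x by blast
    then have cX: "c \<in> X" using C by blast
    have Y_space: "Y k \<omega> \<in> space N" if "k \<in> J" for k
      using indep that \<omega> unfolding indep_vars_def by (auto dest: measurable_space)
    let ?A = "\<lambda>x. (\<Sum>k\<in>J. F x (Y k \<omega>)) / real (card J)"
    have "\<bar>?A x - ?A c\<bar> \<le> h"
    proof -
      have "\<bar>\<Sum>k\<in>J. F x (Y k \<omega>) - F c (Y k \<omega>)\<bar> \<le> (\<Sum>k\<in>J. h)"
        using Hoelder_r[OF x cX _ c(2)] Y_space by (intro order_trans[OF sum_abs] sum_mono) auto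
      then have "\<bar>\<Sum>k\<in>J. F x (Y k \<omega>) - F c (Y k \<omega>)\<bar> / real n \<le> h"
        using n by (simp add: n_def field_simps)
      then show ?thesis
        by (simp add: sum_subtractf diff_divide_distrib[symmetric] n_def)
    qed
    moreover have "\<bar>?f c - ?f x\<bar> \<le> h"
    proof -
      interpret P: prob_space P by fact
      have \<xi>_space: "\<xi> v \<in> space N" if "v \<in> space P" for v using \<xi> that by (rule measurable_space)
      have int: "integrable P (\<lambda>v. F x (\<xi> v))" if "x \<in> X" for x
        using FB[OF that] \<xi>_space measurable_compose[OF \<xi> F[OF that]]
        by (intro P.integrable_const_bound[where B = B] AE_I2) auto
      have "\<bar>?f c - ?f x\<bar> = \<bar>\<integral>v. F c (\<xi> v) - F x (\<xi> v) \<partial>P\<bar>"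
        unfolding true_obj_def using int x cX by simp
      also have "\<dots> \<le> (\<integral>v. \<bar>F c (\<xi> v) - F x (\<xi> v)\<bar> \<partial>P)" by (rule integral_abs_bound)
      also have "\<dots> \<le> (\<integral>v. h \<partial>P)"
      proof (rule integral_mono)
        fix v assume "v \<in> space P"
        then show "\<bar>F c (\<xi> v) - F x (\<xi> v)\<bar> \<le> h"
          using Hoelder_r[OF x cX \<xi>_space c(2)] by (simp add: abs_minus_commute)
      qed (use int x cX in auto)
      finally show ?thesis by (simp add: P.prob_space)
    qed
    ultimately show "\<bar>?A x - ?f x\<bar> \<le> 2 * h + W \<omega>" using W_ge[OF c(1), of \<omega>] by linarith
  qed
qed

theorem theorem3p6:
  fixes P :: "'v measure" and M :: "'w measure"
    and \<Xi> :: "(real ^ 'd) set" and X :: "(real ^ 'p) set"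
    and \<xi> :: "'v \<Rightarrow> real ^ 'd" and \<xi>s :: "nat \<Rightarrow> 'w \<Rightarrow> real ^ 'd"
    and F :: "real ^ 'p \<Rightarrow> real ^ 'd \<Rightarrow> real"
    and sel :: "nat \<Rightarrow> (nat \<Rightarrow> real ^ 'd) \<Rightarrow> real ^ 'p"
    and D L\<^sub>F M\<^sub>F \<gamma> lam \<epsilon> \<rho> :: real and m n :: nat
  defines "\<delta> \<equiv> saa_error X F (true_obj P \<xi> F) n"
    and "\<Delta>\<^sub>N \<equiv> (\<lambda>z. pess_dist (compromise_set X F sel m n \<rho> \<epsilon> z)
                     (eps_argmin X (true_obj P \<xi> F) \<epsilon>))"
    and "D\<^sub>X \<equiv> diameter X"
    and "N\<^sub>F \<equiv> rate_const CARD('p) L\<^sub>F D M\<^sub>F \<gamma> lam"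
  assumes "prob_space P" and "\<xi> \<in> P \<rightarrow>\<^sub>M restrict_space borel \<Xi>"
    and "X \<noteq> {}" and "compact X" and "convex X" and "\<exists>K. is_cube K D \<and> X \<subseteq> K"
    and "\<And>z. z \<in> \<Xi> \<Longrightarrow> continuous_on X (\<lambda>x. F x z)"
    and "\<And>x. x \<in> X \<Longrightarrow> F x \<in> borel_measurable (restrict_space borel \<Xi>)"
    and "0 < \<gamma>" and "\<gamma> \<le> 1"
    and "\<And>x y z. x \<in> X \<Longrightarrow> y \<in> X \<Longrightarrow> z \<in> \<Xi> \<Longrightarrow>
           \<bar>F x z - F y z\<bar> \<le> L\<^sub>F * norm (x - y) powr \<gamma>"
    and "0 < M\<^sub>F"
    and "bdd_above ((\<lambda>(x, z). \<bar>F x z\<bar>) ` (X \<times> \<Xi>))"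
    and "(SUP (x, z)\<in>X \<times> \<Xi>. \<bar>F x z\<bar>) < M\<^sub>F"
    and "\<And>z. z \<in> \<Xi> \<Longrightarrow> convex_on X (\<lambda>x. F x z)"
    and "0 < lam" and "lam < 1 / 2" and "0 < \<epsilon>" and "0 < \<rho>" and "0 < m" and "0 < n"
    and "prob_space M"
    and "prob_space.indep_vars M (\<lambda>_. restrict_space borel \<Xi>) \<xi>s {1..m * n}"
    and "\<And>k. k \<in> {1..m * n} \<Longrightarrow>
           distr M (restrict_space borel \<Xi>) (\<xi>s k) = distr P (restrict_space borel \<Xi>) \<xi>"
    and "\<And>i \<zeta>. i \<in> {1..m} \<Longrightarrow> \<zeta> \<in> {1..n} \<rightarrow>\<^sub>E \<Xi> \<Longrightarrow>
           sel i \<zeta> \<in> eps_argmin X (saa_obj F n \<zeta>) \<epsilon>"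
    and "\<And>i. i \<in> {1..m} \<Longrightarrow>
           (\<lambda>\<omega>. sel i (replication n (\<lambda>k. \<xi>s k \<omega>) i)) \<in> borel_measurable M"
    and "(\<lambda>\<omega>. \<Delta>\<^sub>N (\<lambda>k. \<xi>s k \<omega>)) \<in> borel_measurable M"
  shows "(\<forall>z. (\<forall>k\<in>{1..m * n}. z k \<in> \<Xi>) \<longrightarrow>
            \<Delta>\<^sub>N z \<le> (2 / real m * (\<Sum>j=1..m. \<delta> (replication n z j))
                    + 1 / (real m)\<^sup>2 * (\<Sum>i=1..m. \<Sum>j\<in>{1..m} - {i}.
                        \<delta> (replication n z i) + \<delta> (replication n z j))) / \<epsilon> * D\<^sub>X
                  + 2 * sqrt (\<epsilon> / \<rho>))
    \<and> (\<integral>\<omega>. \<Delta>\<^sub>N (\<lambda>k. \<xi>s k \<omega>) \<partial>M)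
          \<le> D\<^sub>X * N\<^sub>F / \<epsilon> * ((8 * real m - 4) / (real m * real n powr lam)) + 2 * sqrt (\<epsilon> / \<rho>)
    \<and> (\<rho> = real n \<longrightarrow> 0 < D\<^sub>X \<longrightarrow>
         (let C = \<epsilon> powr (3 / 2) / D\<^sub>X + (4 * real m - 2) * N\<^sub>F / real m
          in \<forall>t\<ge>0.
               \<P>(\<omega> in M. \<epsilon> * real n powr lam / (2 * D\<^sub>X) * \<Delta>\<^sub>N (\<lambda>k. \<xi>s k \<omega>) \<ge> C + t)
                 \<le> real m * exp (- ((real m)\<^sup>2 * t\<^sup>2 / (2 * M\<^sub>F\<^sup>2 * (2 * real m - 1)\<^sup>2)))))"
proof -
  interpret P: prob_space P by fact
  interpret M: prob_space M by fact

  \<comment> \<open>Boundedness and convexity of the true objective\<close>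
  define N where "N = restrict_space borel \<Xi>"
  have space_N: "space N = \<Xi>" by (simp add: N_def space_restrict_space)
  note \<xi> = assms(6)[folded N_def] and X_ne = assms(7) and F_meas = assms(12)[folded N_def]
    and \<gamma> = assms(13,14) and Hoelder = assms(15) and MF = assms(16) and FB_bdd = assms(17,18)
    and F_convex = assms(19) and lam = assms(20,21) and \<epsilon> = assms(22) and \<rho> = assms(23)
    and m = assms(24) and n = assms(25) and indep = assms(27)[folded N_def]
    and same_distr = assms(28)[folded N_def] and sel = assms(29)
  have X_bdd: "bounded X" using \<open>compact X\<close> by (rule compact_imp_bounded)
  have D\<^sub>X0: "0 \<le> D\<^sub>X" unfolding assms(3) using X_bdd by (rule diameter_ge_0)
  let ?f = "true_obj P \<xi> F"
  have FB: "\<bar>F x z\<bar> \<le> M\<^sub>F" if "x \<in> X" "z \<in> \<Xi>" for x z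
    using cSUP_upper[OF _ FB_bdd(1), of "(x, z)"] FB_bdd(2) that by simp
  have \<xi>_\<Xi>: "\<xi> v \<in> \<Xi>" if "v \<in> space P" for v
    using measurable_space[OF \<xi> that] by (simp add: space_N)
  have F_int: "integrable P (\<lambda>v. F x (\<xi> v))" if "x \<in> X" for x
    using FB[OF that] \<xi>_\<Xi> measurable_compose[OF \<xi> F_meas[OF that]]
    by (intro P.integrable_const_bound[where B = M\<^sub>F] AE_I2) auto
  have f_bound: "\<bar>?f x\<bar> \<le> M\<^sub>F" if "x \<in> X" for x
  proof -
    have "\<bar>?f x\<bar> \<le> (\<integral>v. \<bar>F x (\<xi> v)\<bar> \<partial>P)" unfolding true_obj_def by (rule integral_abs_bound)
    also have "\<dots> \<le> (\<integral>v. M\<^sub>F \<partial>P)" using FB[OF that] \<xi>_\<Xi> F_int[OF that] by (intro integral_mono) auto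
    finally show ?thesis by (simp add: P.prob_space)
  qed
  have f_bdd: "bdd_below (?f ` X)"
  proof (rule bdd_belowI2)
    show "- M\<^sub>F \<le> ?f x" if "x \<in> X" for x using f_bound[OF that] by linarith
  qed
  have f_convex: "convex_on X ?f"
  proof (rule convex_onI[OF _ \<open>convex X\<close>])
    fix t :: real and x y assume t: "0 < t" "t < 1" and x: "x \<in> X" and y: "y \<in> X"
    have xy: "(1 - t) *\<^sub>R x + t *\<^sub>R y \<in> X" using \<open>convex X\<close> x y t by (intro convexD) auto
    have "?f ((1 - t) *\<^sub>R x + t *\<^sub>R y) \<le> (\<integral>v. (1 - t) * F x (\<xi> v) + t * F y (\<xi> v) \<partial>P)"
      unfolding true_obj_def
      using F_int x y xy t convex_onD[OF F_convex[OF \<xi>_\<Xi>]] by (intro integral_mono) auto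
    also have "\<dots> = (1 - t) * ?f x + t * ?f y"
      unfolding true_obj_def using F_int x y by simp
    finally show "?f ((1 - t) *\<^sub>R x + t *\<^sub>R y) \<le> (1 - t) * ?f x + t * ?f y" .
  qed

  \<comment> \<open>The deterministic bound for every realization\<close>
  have part1: "\<Delta>\<^sub>N z \<le> (2 / real m * (\<Sum>j=1..m. \<delta> (replication n z j))
                    + 1 / (real m)\<^sup>2 * (\<Sum>i=1..m. \<Sum>j\<in>{1..m} - {i}.
                        \<delta> (replication n z i) + \<delta> (replication n z j))) / \<epsilon> * D\<^sub>X
                  + 2 * sqrt (\<epsilon> / \<rho>)" (is "_ \<le> ?R")
    if z: "\<forall>k\<in>{1..m * n}. z k \<in> \<Xi>" for z
  proof -
    let ?g = "\<lambda>i. saa_obj F n (replication n z i)"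
    \<comment> \<open>The restriction in \<open>replication\<close> yields membership in the
      extensional function space, on which the selections are known to be
      \<open>\<epsilon>\<close>-optimal.\<close>
    have rep: "replication n z i \<in> {1..n} \<rightarrow>\<^sub>E \<Xi>" if "i \<in> {1..m}" for i
      unfolding replication_def using z replication_index[OF that] by auto
    have rep_\<Xi>: "replication n z i j \<in> \<Xi>" if "i \<in> {1..m}" "j \<in> {1..n}" for i j
      using rep[OF that(1)] that(2) by (rule PiE_mem)
    have g_bound: "\<bar>?g i x\<bar> \<le> M\<^sub>F" if "i \<in> {1..m}" "x \<in> X" for i x
      using FB[OF that(2)] rep_\<Xi>[OF that(1)] n by (intro abs_saa_obj_le) auto
    have g_convex: "convex_on X (?g i)" if "i \<in> {1..m}" for i
      using \<open>convex X\<close> by (intro convex_on_saa_obj F_convex rep_\<Xi>[OF that])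
    have err: "\<bar>?g i x - ?f x\<bar> \<le> \<delta> (replication n z i)" if i: "i \<in> {1..m}" and x: "x \<in> X" for i x
      unfolding assms(1) saa_error_def
    proof (rule cSUP_upper[OF x], rule bdd_aboveI2)
      show "\<bar>?g i x - ?f x\<bar> \<le> 2 * M\<^sub>F" if "x \<in> X" for x
        using g_bound[OF i that] f_bound[OF that] by linarith
    qed
    have obj: "compromise_obj F sel m n \<rho> z = (\<lambda>x. 1 / real m * (\<Sum>i=1..m. ?g i x)
        + \<rho> / 2 * (norm (x - (1 / real m) *\<^sub>R (\<Sum>i=1..m. sel i (replication n z i))))\<^sup>2)"
      by (simp add: fun_eq_iff compromise_obj_def avg_obj_def avg_decision_def)
    have obj_bdd: "bdd_below (compromise_obj F sel m n \<rho> z ` X)"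
    proof (rule bdd_belowI2)
      fix x assume "x \<in> X"
      then have "1 / real m * (\<Sum>i=1..m. - M\<^sub>F) \<le> 1 / real m * (\<Sum>i=1..m. ?g i x)"
        using g_bound by (intro mult_left_mono sum_mono) (auto simp: abs_le_iff minus_le_iff)
      moreover have "0 \<le> \<rho> / 2 * (norm (x - (1 / real m) *\<^sub>R (\<Sum>i=1..m. sel i (replication n z i))))\<^sup>2"
        using \<rho> by simp
      ultimately show "1 / real m * (\<Sum>i=1..m. - M\<^sub>F) \<le> compromise_obj F sel m n \<rho> z x"
        unfolding obj by linarith
    qed
    show ?thesis
      unfolding assms(2)
    proof (rule pess_dist_le)
      show "compromise_set X F sel m n \<rho> \<epsilon> z \<noteq> {}"
        unfolding compromise_set_def using X_ne obj_bdd \<epsilon> by (rule eps_argmin_nonempty)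
      fix x assume x: "x \<in> compromise_set X F sel m n \<rho> \<epsilon> z"
      obtain b where "b \<in> eps_argmin X ?f \<epsilon>" "norm (x - b) \<le> ?R"
        using compromise_dist_le[OF f_convex X_bdd f_bdd g_convex err sel[OF _ rep]
            x[unfolded compromise_set_def obj] \<epsilon> \<rho> m] unfolding assms(3) by blast
      then show "\<exists>b\<in>eps_argmin X ?f \<epsilon>. norm (x - b) \<le> ?R" by blast
    qed
  qed

  \<comment> \<open>Integrable majorants of the replication errors\<close>
  define \<kappa> where "\<kappa> = (4 * real m - 2) / (real m)\<^sup>2 / \<epsilon> * D\<^sub>X"
  have \<kappa>0: "0 \<le> \<kappa>" using m \<epsilon> D\<^sub>X0 by (simp add: \<kappa>_def)
  have \<xi>s_\<Xi>: "\<xi>s k \<omega> \<in> \<Xi>" if "k \<in> {1..m * n}" "\<omega> \<in> space M" for k \<omega>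
    using indep that space_N unfolding M.indep_vars_def by (auto dest: measurable_space)
  have \<Delta>_le: "\<Delta>\<^sub>N (\<lambda>k. \<xi>s k \<omega>) \<le> \<kappa> * (\<Sum>i=1..m. \<delta> (replication n (\<lambda>k. \<xi>s k \<omega>) i)) + 2 * sqrt (\<epsilon> / \<rho>)"
    if \<omega>: "\<omega> \<in> space M" for \<omega>
  proof -
    let ?d = "\<lambda>i. \<delta> (replication n (\<lambda>k. \<xi>s k \<omega>) i)"
    \<comment> \<open>The coefficients add up to
      \<open>2 / m + 2 * (m - 1) / m\<^sup>2 = (4 * m - 2) / m\<^sup>2\<close>.\<close>
    have "(2 / real m * (\<Sum>j=1..m. ?d j)
           + 1 / (real m)\<^sup>2 * (\<Sum>i=1..m. \<Sum>j\<in>{1..m} - {i}. ?d i + ?d j)) / \<epsilon> * D\<^sub>X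
        = \<kappa> * (\<Sum>i=1..m. ?d i)"
      unfolding sum_off_diagonal_pairs[OF m] \<kappa>_def using m \<epsilon>
      by (simp add: field_simps power2_eq_square)
    then show ?thesis using part1[of "\<lambda>k. \<xi>s k \<omega>"] \<xi>s_\<Xi>[OF _ \<omega>] by simp
  qed
  define \<beta> where "\<beta> = 2 * N\<^sub>F / real n powr lam"
  define majorant where "majorant i V \<longleftrightarrow> integrable M V \<and> (\<forall>\<omega>. 0 \<le> V \<omega>)
        \<and> (\<forall>\<omega>\<in>space M. \<delta> (replication n (\<lambda>k. \<xi>s k \<omega>) i) \<le> V \<omega>)
        \<and> (\<integral>\<omega>. V \<omega> \<partial>M) \<le> \<beta>
        \<and> (\<forall>u\<ge>0. \<P>(\<omega> in M. \<beta> + u \<le> V \<omega>) \<le> exp (- (real n * u\<^sup>2 / (2 * M\<^sub>F\<^sup>2))))"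
    for i V
  have majorant: "\<exists>V. majorant i V" if i: "i \<in> {1..m}" and pos: "0 < D\<^sub>X" for i
  proof -
    obtain K where K: "is_cube K D" "X \<subseteq> K" using assms(10) by blast
    \<comment> \<open>The sign comes from the Hoelder condition at two distinct points of
      \<open>X\<close>; this is where the positive diameter enters.\<close>
    have L: "0 \<le> L\<^sub>F"
    proof -
      have "\<exists>x\<in>X. \<exists>y\<in>X. x \<noteq> y"
      proof (rule ccontr)
        assume "\<not> ?thesis"
        then obtain x where "X = {x}" using X_ne by blast
        then show False using pos by (simp add: assms(3))
      qed
      then obtain x y where xy: "x \<in> X" "y \<in> X" "x \<noteq> y" by blast
      obtain v where "v \<in> space P" using P.not_empty by blast
      then have "0 \<le> L\<^sub>F * norm (x - y) powr \<gamma>"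
        using Hoelder[OF xy(1,2) \<xi>_\<Xi>] abs_ge_zero order_trans by blast
      then show ?thesis using xy by (simp add: zero_le_mult_iff)
    qed
    define J where "J = {(i - 1) * n + 1..(i - 1) * n + n}"
    have card_J: "card J = n" by (simp add: J_def)
    have J_sub: "J \<subseteq> {1..m * n}"
    proof
      fix k assume "k \<in> J"
      then have "k = (i - 1) * n + (k - (i - 1) * n)" "k - (i - 1) * n \<in> {1..n}" by (auto simp: J_def)
      then show "k \<in> {1..m * n}" using replication_index[OF i] by metis
    qed
    have J: "finite J" "J \<noteq> {}" using n by (auto simp: J_def)
    have distr_J: "distr M N (\<xi>s k) = distr P N \<xi>" if "k \<in> J" for k
      using same_distr J_sub that by blast
    obtain V where V: "integrable M V" "\<And>\<omega>. 0 \<le> V \<omega>"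
      "\<And>x \<omega>. x \<in> X \<Longrightarrow> \<omega> \<in> space M \<Longrightarrow>
           \<bar>(\<Sum>k\<in>J. F x (\<xi>s k \<omega>)) / real n - ?f x\<bar> \<le> V \<omega>"
      "(\<integral>\<omega>. V \<omega> \<partial>M) \<le> \<beta>"
      "\<And>u. 0 \<le> u \<Longrightarrow> \<P>(\<omega> in M. \<beta> + u \<le> V \<omega>) \<le> exp (- (real n * u\<^sup>2 / (2 * M\<^sub>F\<^sup>2)))"
      unfolding \<beta>_def assms(4) card_J[symmetric]
    proof (rule M.sample_error_majorant[OF K X_ne J M.indep_vars_subset[OF indep J_sub] distr_J \<xi>
            \<open>prob_space P\<close> F_meas _ MF _ L \<gamma> lam])
    qed (use FB Hoelder in \<open>auto simp: space_N\<close>)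
    have "\<delta> (replication n (\<lambda>k. \<xi>s k \<omega>) i) \<le> V \<omega>" if "\<omega> \<in> space M" for \<omega>
      unfolding assms(1) saa_error_def
    proof (rule cSUP_least[OF X_ne])
      fix x assume "x \<in> X"
      then show "\<bar>saa_obj F n (replication n (\<lambda>k. \<xi>s k \<omega>) i) x - ?f x\<bar> \<le> V \<omega>"
        using V(3)[OF _ that] i by (subst saa_obj_replication) (auto simp: J_def)
    qed
    then show ?thesis using V unfolding majorant_def by blast
  qed
  have majorants: "\<exists>V. \<forall>i\<in>{1..m}. majorant i (V i)" if "0 < D\<^sub>X"
    using majorant[OF _ that] by (intro bchoice) blast
  have tail0: "0 \<le> 2 * sqrt (\<epsilon> / \<rho>)" using \<epsilon> \<rho> by simp

  \<comment> \<open>The bound in expectation\<close>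
  have part2: "(\<integral>\<omega>. \<Delta>\<^sub>N (\<lambda>k. \<xi>s k \<omega>) \<partial>M)
          \<le> D\<^sub>X * N\<^sub>F / \<epsilon> * ((8 * real m - 4) / (real m * real n powr lam)) + 2 * sqrt (\<epsilon> / \<rho>)"
  proof (cases "D\<^sub>X = 0")
    case True \<comment> \<open>\<open>X\<close> is a singleton, so \<open>L\<^sub>F\<close> and \<open>N\<^sub>F\<close> may be negative here\<close>
    then have "(\<integral>\<omega>. \<Delta>\<^sub>N (\<lambda>k. \<xi>s k \<omega>) \<partial>M) \<le> (\<integral>\<omega>. 2 * sqrt (\<epsilon> / \<rho>) \<partial>M)"
      using \<Delta>_le tail0 by (intro integral_mono') (auto simp: \<kappa>_def)
    then show ?thesis using True by (simp add: M.prob_space)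
  next
    case False
    then have "0 < D\<^sub>X" using D\<^sub>X0 by simp
    then obtain V where maj: "\<forall>i\<in>{1..m}. majorant i (V i)" using majorants by blast
    have V: "\<And>i. i \<in> {1..m} \<Longrightarrow> integrable M (V i)"
      "\<And>i \<omega>. i \<in> {1..m} \<Longrightarrow> 0 \<le> V i \<omega>"
      "\<And>i \<omega>. i \<in> {1..m} \<Longrightarrow> \<omega> \<in> space M \<Longrightarrow> \<delta> (replication n (\<lambda>k. \<xi>s k \<omega>) i) \<le> V i \<omega>"
      "\<And>i. i \<in> {1..m} \<Longrightarrow> (\<integral>\<omega>. V i \<omega> \<partial>M) \<le> \<beta>"
      using maj unfolding majorant_def by blast+
    have V_int: "integrable M (\<lambda>\<omega>. \<Sum>i=1..m. V i \<omega>)"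
      by (intro Bochner_Integration.integrable_sum V(1))
    have V_sum: "(\<integral>\<omega>. (\<Sum>i=1..m. V i \<omega>) \<partial>M) = (\<Sum>i=1..m. \<integral>\<omega>. V i \<omega> \<partial>M)"
      by (intro Bochner_Integration.integral_sum V(1))
    have "(\<integral>\<omega>. \<Delta>\<^sub>N (\<lambda>k. \<xi>s k \<omega>) \<partial>M) \<le> (\<integral>\<omega>. \<kappa> * (\<Sum>i=1..m. V i \<omega>) + 2 * sqrt (\<epsilon> / \<rho>) \<partial>M)"
    \<comment> \<open>The majorant is integrable and nonnegative, and a nonintegrable function has
      integral 0, so the integrability of the distance need not be shown.\<close>
    proof (rule integral_mono')
      fix \<omega> assume \<omega>: "\<omega> \<in> space M"
      show "0 \<le> \<kappa> * (\<Sum>i=1..m. V i \<omega>) + 2 * sqrt (\<epsilon> / \<rho>)"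
        using V(2) by (intro add_nonneg_nonneg[OF _ tail0] mult_nonneg_nonneg[OF \<kappa>0] sum_nonneg)
      have "\<kappa> * (\<Sum>i=1..m. \<delta> (replication n (\<lambda>k. \<xi>s k \<omega>) i)) \<le> \<kappa> * (\<Sum>i=1..m. V i \<omega>)"
        using \<kappa>0 V(3) \<omega> by (intro mult_left_mono sum_mono) auto
      then show "\<Delta>\<^sub>N (\<lambda>k. \<xi>s k \<omega>) \<le> \<kappa> * (\<Sum>i=1..m. V i \<omega>) + 2 * sqrt (\<epsilon> / \<rho>)"
        using \<Delta>_le[OF \<omega>] by linarith
    next
      show "integrable M (\<lambda>\<omega>. \<kappa> * (\<Sum>i=1..m. V i \<omega>) + 2 * sqrt (\<epsilon> / \<rho>))"
        using V_int by simp
    qed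
    also have "\<dots> = \<kappa> * (\<Sum>i=1..m. \<integral>\<omega>. V i \<omega> \<partial>M) + 2 * sqrt (\<epsilon> / \<rho>)"
      unfolding V_sum[symmetric] using V_int by (simp add: M.prob_space)
    also have "\<dots> \<le> \<kappa> * (\<Sum>i=1..m. \<beta>) + 2 * sqrt (\<epsilon> / \<rho>)"
      using \<kappa>0 V(4) by (intro add_right_mono mult_left_mono sum_mono) auto
    also have "\<kappa> * (\<Sum>i=1..m. \<beta>) = D\<^sub>X * N\<^sub>F / \<epsilon> * ((8 * real m - 4) / (real m * real n powr lam))"
      using m n \<epsilon> by (simp add: \<kappa>_def \<beta>_def field_simps power2_eq_square)
    finally show ?thesis .
  qed

  \<comment> \<open>The tail bound\<close>
  have part3: "\<P>(\<omega> in M. \<epsilon> * real n powr lam / (2 * D\<^sub>X) * \<Delta>\<^sub>N (\<lambda>k. \<xi>s k \<omega>)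
                   \<ge> \<epsilon> powr (3 / 2) / D\<^sub>X + (4 * real m - 2) * N\<^sub>F / real m + t)
                 \<le> real m * exp (- ((real m)\<^sup>2 * t\<^sup>2 / (2 * M\<^sub>F\<^sup>2 * (2 * real m - 1)\<^sup>2)))"
    if \<rho>n: "\<rho> = real n" and pos: "0 < D\<^sub>X" and t: "0 \<le> t" for t
  proof -
    obtain V where maj: "\<forall>i\<in>{1..m}. majorant i (V i)" using majorants pos by blast
    have V: "\<And>i. i \<in> {1..m} \<Longrightarrow> integrable M (V i)"
      "\<And>i \<omega>. i \<in> {1..m} \<Longrightarrow> \<omega> \<in> space M \<Longrightarrow> \<delta> (replication n (\<lambda>k. \<xi>s k \<omega>) i) \<le> V i \<omega>"
      "\<And>i u. i \<in> {1..m} \<Longrightarrow> 0 \<le> u \<Longrightarrow>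
         \<P>(\<omega> in M. \<beta> + u \<le> V i \<omega>) \<le> exp (- (real n * u\<^sup>2 / (2 * M\<^sub>F\<^sup>2)))"
      using maj unfolding majorant_def by blast+
    define q where "q = real n powr lam"
    \<comment> \<open>Chosen so that \<open>q * ((2 * m - 1) / m) * u = t\<close>: this is the
      deviation of each replication error that corresponds to \<open>t\<close> after
      scaling.\<close>
    define u where "u = t * real m / ((2 * real m - 1) * q)"
    let ?C = "\<epsilon> powr (3 / 2) / D\<^sub>X + (4 * real m - 2) * N\<^sub>F / real m"
    let ?s = "\<epsilon> * q / (2 * D\<^sub>X)"
    have q: "0 < q" using n by (simp add: q_def)
    \<comment> \<open>Used twice: for \<open>\<rho> = n\<close> it bounds the scaled proximal term,
      and later it replaces \<open>n\<close> by \<open>q\<^sup>2\<close> in the exponent.\<close>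
    have q2: "q\<^sup>2 \<le> real n"
    proof -
      have "q\<^sup>2 = real n powr (2 * lam)" by (simp add: q_def power2_eq_square powr_add[symmetric])
      also have "\<dots> \<le> real n powr 1" using n lam by (intro powr_mono) auto
      finally show ?thesis using n by simp
    qed
    have m1: "0 < 2 * real m - 1" using m by simp
    have u0: "0 \<le> u" using t m1 q by (simp add: u_def)
    have s0: "0 < ?s" using \<epsilon> q pos by simp
    have tail: "?s * (2 * sqrt (\<epsilon> / \<rho>)) \<le> \<epsilon> powr (3 / 2) / D\<^sub>X"
    proof -
      have e32: "\<epsilon> powr (3 / 2) = \<epsilon> * sqrt \<epsilon>"
        using powr_add[of \<epsilon> 1 "1 / 2"] \<epsilon> by (simp add: powr_half_sqrt)
      have "q \<le> sqrt (real n)" using q2 by (rule real_le_rsqrt)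
      then have "q / sqrt (real n) \<le> 1" using n by simp
      then have "\<epsilon> * sqrt \<epsilon> / D\<^sub>X * (q / sqrt (real n)) \<le> \<epsilon> * sqrt \<epsilon> / D\<^sub>X * 1"
        using \<epsilon> pos by (intro mult_left_mono) auto
      then show ?thesis
        unfolding e32 \<rho>n by (simp add: real_sqrt_divide mult_ac)
    qed
    have main: "?s * (\<kappa> * (real m * (\<beta> + u))) = (4 * real m - 2) * N\<^sub>F / real m + t"
    proof -
      have "?s * (\<kappa> * (real m * (\<beta> + u))) = q * ((2 * real m - 1) / real m) * (\<beta> + u)"
        using \<epsilon> pos m by (simp add: \<kappa>_def field_simps power2_eq_square)
      also have "\<dots> = q * ((2 * real m - 1) / real m) * \<beta> + q * ((2 * real m - 1) / real m) * u"
        by (rule distrib_left)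
      also have "q * ((2 * real m - 1) / real m) * \<beta> = (4 * real m - 2) * N\<^sub>F / real m"
        using q m by (simp add: \<beta>_def q_def[symmetric] field_simps)
      also have "q * ((2 * real m - 1) / real m) * u = t"
        using q m m1 by (simp add: u_def)
      finally show ?thesis .
    qed
    have \<kappa>_pos: "0 < \<kappa>" using m \<epsilon> pos by (simp add: \<kappa>_def)
    \<comment> \<open>If every majorant stays below \<open>\<beta> + u\<close>, the deterministic
      bound keeps the scaled distance strictly below the threshold. The union over the replications
      produces the factor \<open>m\<close>.\<close>
    have "{\<omega> \<in> space M. ?s * \<Delta>\<^sub>N (\<lambda>k. \<xi>s k \<omega>) \<ge> ?C + t}
        \<subseteq> (\<Union>i\<in>{1..m}. {\<omega> \<in> space M. \<beta> + u \<le> V i \<omega>})"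
    proof (rule subsetI, rule ccontr)
      fix \<omega> assume "\<omega> \<in> {\<omega> \<in> space M. ?s * \<Delta>\<^sub>N (\<lambda>k. \<xi>s k \<omega>) \<ge> ?C + t}"
        and not: "\<omega> \<notin> (\<Union>i\<in>{1..m}. {\<omega> \<in> space M. \<beta> + u \<le> V i \<omega>})"
      then have \<omega>: "\<omega> \<in> space M" and ge: "?s * \<Delta>\<^sub>N (\<lambda>k. \<xi>s k \<omega>) \<ge> ?C + t" by auto
      have "(\<Sum>i=1..m. \<delta> (replication n (\<lambda>k. \<xi>s k \<omega>) i)) < (\<Sum>i=1..m. \<beta> + u)"
      proof (rule sum_strict_mono)
        fix i assume "i \<in> {1..m}"
        then show "\<delta> (replication n (\<lambda>k. \<xi>s k \<omega>) i) < \<beta> + u"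
          using V(2)[OF _ \<omega>, of i] not \<omega> by force
      qed (use m in auto)
      then have "\<kappa> * (\<Sum>i=1..m. \<delta> (replication n (\<lambda>k. \<xi>s k \<omega>) i)) < \<kappa> * (real m * (\<beta> + u))"
        using \<kappa>_pos by simp
      then have "\<Delta>\<^sub>N (\<lambda>k. \<xi>s k \<omega>) < \<kappa> * (real m * (\<beta> + u)) + 2 * sqrt (\<epsilon> / \<rho>)"
        using \<Delta>_le[OF \<omega>] by linarith
      then have "?s * \<Delta>\<^sub>N (\<lambda>k. \<xi>s k \<omega>) < ?s * (\<kappa> * (real m * (\<beta> + u)) + 2 * sqrt (\<epsilon> / \<rho>))"
        using s0 by (rule mult_strict_left_mono)
      also have "\<dots> \<le> ?C + t"
        using tail main by (simp only: distrib_left)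
      finally show False using ge by linarith
    qed
    then have "\<P>(\<omega> in M. ?s * \<Delta>\<^sub>N (\<lambda>k. \<xi>s k \<omega>) \<ge> ?C + t)
        \<le> M.prob (\<Union>i\<in>{1..m}. {\<omega> \<in> space M. \<beta> + u \<le> V i \<omega>})"
      using V(1) by (intro M.finite_measure_mono) auto
    also have "\<dots> \<le> (\<Sum>i=1..m. \<P>(\<omega> in M. \<beta> + u \<le> V i \<omega>))"
      using V(1) by (intro M.finite_measure_subadditive_finite) auto
    also have "\<dots> \<le> (\<Sum>i=1..m. exp (- ((real m)\<^sup>2 * t\<^sup>2 / (2 * M\<^sub>F\<^sup>2 * (2 * real m - 1)\<^sup>2))))"
    proof (rule sum_mono)
      fix i assume i: "i \<in> {1..m}"
      have "(real m)\<^sup>2 * t\<^sup>2 / (2 * M\<^sub>F\<^sup>2 * (2 * real m - 1)\<^sup>2) = q\<^sup>2 * u\<^sup>2 / (2 * M\<^sub>F\<^sup>2)"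
        using q by (simp add: u_def power_divide power_mult_distrib mult_ac)
      also have "\<dots> \<le> real n * u\<^sup>2 / (2 * M\<^sub>F\<^sup>2)"
        using q2 by (intro divide_right_mono mult_right_mono) auto
      finally show "\<P>(\<omega> in M. \<beta> + u \<le> V i \<omega>)
          \<le> exp (- ((real m)\<^sup>2 * t\<^sup>2 / (2 * M\<^sub>F\<^sup>2 * (2 * real m - 1)\<^sup>2)))"
        using V(3)[OF i u0] by (meson exp_le_cancel_iff neg_le_iff_le order_trans)
    qed
    finally show ?thesis by (simp add: q_def)
  qed

  show ?thesis
    using part1 part2 part3 by (auto simp: Let_def)
qed

end
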